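(* Let $$A=36893488147419103230\quad\text{and}\quad B=10691053702625738573.$$ The arithmetic progression $Am+B$, where $m$ ranges over the nonnegative integers, contains infinitely many primes that are Sierpiński numbers.
   Context: A Sierpiński number is a positive odd integer $k$ such that $k\cdot 2^n+1$ is composite for all nonnegative integers $n$. *)

theory Defs
  imports Complex_Main "HOL-Computational_Algebra.Primes"
begin

definition composite :: "nat \<Rightarrow> bool" where
  "composite n \<longleftrightarrow> n > 1 \<and> \<not> prime n"

definition sierpinski_number :: "nat \<Rightarrow> bool" where
  "sierpinski_number k \<longleftrightarrow> k > 0 \<and> odd k \<and> (\<forall>n::nat. composite (k * 2 ^ n + 1))"

end

theory Submission
  imports Defs "HOL-Number_Theory.Number_Theory" "HOL-Computational_Algebra.Squarefree"
begin

text \<open>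
  $A = 2(2^{64} - 1) = 2 \cdot 3 \cdot 5 \cdot 17 \cdot 257 \cdot 641 \cdot 65537 \cdot 6700417$, and
  $B \equiv 1/2$ modulo each of these odd primes except $641$, where $B \equiv -1/2$. Since $2$ has order
  $2, 4, 8, 16, 32, 64, 64$ modulo $3, 5, 17, 257, 65537, 641, 6700417$, the residue classes of exponents $n$
  for which one of these primes divides $k 2^n + 1$, $k \equiv B$, cover all integers: $0$ mod $2$, $3$ mod $4$,
  $5$ mod $8$, $9$ mod $16$, $17$ mod $32$, $33$ mod $64$ and $1$ mod $64$. So every term of the progression is
  a Sierpinski number, and Dirichlet's theorem provides the primes.

  Dirichlet's theorem is proved in Shapiro's elementary way, by estimating
  $S_\chi(N) = \sum_{n \leq N} \chi(n) \Lambda(n) / n$. For a nonprincipal $\chi$, evaluating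
  $\sum_{n \leq N} \chi(n) \ln n / n = O(1)$ with $\ln = \Lambda * 1$ shows $S_\chi(N) = O(1)$ if
  $L(1,\chi) \neq 0$. If $L(1,\chi) = 0$, evaluating
  $\sum_{n \leq N} \chi(n)/n \sum_{d \mid n} \mu(d) \ln (N/d)$ in two ways shows
  $S_\chi(N) = -\ln N + O(1)$. As $\sum_\chi S_\chi(N) \geq 0$ and $S_{\chi_0}(N) = \ln N + O(1)$, at most one
  $L(1,\chi)$ vanishes, and then $\chi = \overline{\chi}$. For real $\chi$ the sum
  $\sum_{n \leq M^2} (1 * \chi)(n) / \sqrt n$ is at least $\ln M$, because $1 * \chi$ is nonnegative and at least
  $1$ at squares, but it is bounded if $L(1,\chi) = 0$.
\<close>

section \<open>Chebyshev and Mertens estimates, Moebius inversion\<close>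

text \<open>With \<open>n = d * m\<close>, both sides run over the pairs satisfying
  \<open>d * m \<le> N\<close>. Every Dirichlet convolution below is summed in this form.\<close>

lemma sum_divisors_rearrange:
  fixes f :: "nat \<Rightarrow> nat \<Rightarrow> 'a :: comm_monoid_add"
  shows "(\<Sum>n=1..N. \<Sum>d | d dvd n. f d (n div d)) = (\<Sum>d=1..N. \<Sum>m=1..N div d. f d m)"
proof -
  have "(\<Sum>n=1..N. \<Sum>d | d dvd n. f d (n div d))
      = (\<Sum>(n, d)\<in>(SIGMA n:{1..N}. {d. d dvd n}). f d (n div d))"
    by (rule sum.Sigma) auto
  also have "\<dots> = (\<Sum>(d, m)\<in>(SIGMA d:{1..N}. {1..N div d}). f d m)"
  proof (rule sum.reindex_bij_witness[where i = "\<lambda>(d, m). (d * m, d)" and j = "\<lambda>(n, d). (d, n div d)"])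
    fix a assume a: "a \<in> (SIGMA n:{1..N}. {d. d dvd n})"
    then obtain d m where "a = (d * m, d)" "1 \<le> d * m" "d * m \<le> N"
      by (auto elim!: dvdE)
    then show "(case case a of (n, d) \<Rightarrow> (d, n div d) of (d, m) \<Rightarrow> (d * m, d)) = a"
      and "(case a of (n, d) \<Rightarrow> (d, n div d)) \<in> (SIGMA d:{1..N}. {1..N div d})"
      by (auto simp: less_eq_div_iff_mult_less_eq mult.commute Suc_le_eq intro: order.trans[rotated])
  next
    fix b assume "b \<in> (SIGMA d:{1..N}. {1..N div d})"
    then show "(case case b of (d, m) \<Rightarrow> (d * m, d) of (n, d) \<Rightarrow> (d, n div d)) = b"
      and "(case b of (d, m) \<Rightarrow> (d * m, d)) \<in> (SIGMA n:{1..N}. {d. d dvd n})"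
      by (auto simp: less_eq_div_iff_mult_less_eq mult.commute Suc_le_eq)
  qed auto
  also have "\<dots> = (\<Sum>d=1..N. \<Sum>m=1..N div d. f d m)"
    by (rule sum.Sigma[symmetric]) auto
  finally show ?thesis .
qed

lemma real_divide_less_div_add_1: "real N / real d < real (N div d) + 1"
  using real_of_int_floor_add_one_gt[of "real N / real d"]
  by (simp add: floor_divide_of_nat_eq)

text \<open>Legendre's formula, obtained by summing the convolution identity for \<open>ln\<close>
  over all \<open>n \<le> N\<close>; \<open>N div d\<close> counts the multiples of
  \<open>d\<close>.\<close>

lemma ln_fact_eq_sum_mangoldt:
  "(\<Sum>d=1..N. mangoldt d * real (N div d)) = ln (fact N :: real)"
proof -
  have "ln (fact N :: real) = (\<Sum>n=1..N. ln (real n))"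
    unfolding fact_prod of_nat_prod by (intro ln_prod) auto
  also have "\<dots> = (\<Sum>n=1..N. \<Sum>d | d dvd n. mangoldt d)"
    by (intro sum.cong refl) (simp add: mangoldt_sum)
  also have "\<dots> = (\<Sum>d=1..N. \<Sum>m=1..N div d. mangoldt d)"
    by (rule sum_divisors_rearrange)
  finally show ?thesis by (simp add: mult.commute)
qed

text \<open>A weak Stirling bound. The induction step is
  \<open>ln (1 + 1 / N) \<le> 1 / N\<close>.\<close>

lemma ln_fact_ge: "ln (fact N :: real) \<ge> real N * ln (real N) - real N"
proof (induction N)
  case (Suc N)
  have "real (Suc N) * ln (real (Suc N)) - real (Suc N)
      \<le> ln (real (Suc N)) + (real N * ln (real N) - real N)"
  proof (cases "N = 0")
    case False
    have "ln (real (Suc N) / real N) \<le> real (Suc N) / real N - 1"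
      using False by (intro ln_le_minus_one) auto
    then have "real N * (ln (real (Suc N)) - ln (real N)) \<le> 1"
      using False by (simp add: ln_div field_simps)
    then show ?thesis by (simp add: algebra_simps)
  qed auto
  also have "\<dots> \<le> ln (real (Suc N)) + ln (fact N)" using Suc by simp
  also have "\<dots> = ln (fact (Suc N) :: real)" by (simp add: ln_mult)
  finally show ?case .
qed auto

lemma ln_fact_le: "ln (fact N :: real) \<le> real N * ln (real N)"
proof (cases "N = 0")
  case False
  have "ln (fact N :: real) \<le> ln (real N ^ N)"
    using fact_le_power[of N, where 'a = real] False by (subst ln_le_cancel_iff) auto
  then show ?thesis using False by (simp add: ln_realpow)
qed auto

section \<open>Chebyshev's upper bound and Mertens' estimate\<close>

definition chebyshev_psi :: "nat \<Rightarrow> real" where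
  "chebyshev_psi N = (\<Sum>d=1..N. mangoldt d)"

text \<open>Chebyshev's argument. By Legendre's formula the logarithm of the central binomial
  coefficient weights \<open>mangoldt d\<close> by \<open>2 * n div d - 2 * (n div d)\<close>, which
  is never negative and equals 1 for \<open>n < d \<le> 2 * n\<close>; the coefficient itself is at
  most \<open>2 ^ (2 * n)\<close>.\<close>

lemma chebyshev_psi_double: "chebyshev_psi (2 * n) - chebyshev_psi n \<le> real (2 * n) * ln 2"
proof -
  have split: "{1..2*n} = {1..n} \<union> {n+1..2*n}" by auto
  have "chebyshev_psi (2 * n) - chebyshev_psi n = (\<Sum>d=n+1..2*n. mangoldt d)"
    unfolding chebyshev_psi_def by (subst split, subst sum.union_disjoint) auto
  also have "\<dots> = (\<Sum>d\<in>{n+1..2*n}. mangoldt d * real (2*n div d - 2 * (n div d)))"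
  proof (intro sum.cong refl)
    fix d assume d: "d \<in> {n+1..2*n}"
    have "2 * n div d = 1" using d by (intro div_nat_eqI) auto
    then show "mangoldt d = mangoldt d * real (2*n div d - 2 * (n div d))" using d by simp
  qed
  also have "\<dots> \<le> (\<Sum>d=1..2*n. mangoldt d * real (2*n div d - 2 * (n div d)))"
    by (intro sum_mono2) (auto simp: mangoldt_nonneg)
  also have "\<dots> = (\<Sum>d=1..2*n. mangoldt d * real (2*n div d) - 2 * (mangoldt d * real (n div d)))"
  proof (intro sum.cong refl)
    fix d :: nat
    \<comment> \<open>The difference was taken in the natural numbers; this inequality shows that it
      is not truncated, so it agrees with the real one.\<close>
    have "2 * (n div d) \<le> 2 * n div d"
      by (cases "d = 0") (auto simp: less_eq_div_iff_mult_less_eq)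
    then show "mangoldt d * real (2*n div d - 2 * (n div d))
        = mangoldt d * real (2*n div d) - 2 * (mangoldt d * real (n div d))"
      by (simp add: of_nat_diff algebra_simps)
  qed
  also have "\<dots> = (\<Sum>d=1..2*n. mangoldt d * real (2*n div d)) - 2 * (\<Sum>d=1..2*n. mangoldt d * real (n div d))"
    by (simp add: sum_subtractf sum_distrib_left)
  also have "(\<Sum>d=1..2*n. mangoldt d * real (n div d)) = (\<Sum>d=1..n. mangoldt d * real (n div d))"
    by (intro sum.mono_neutral_right) auto
  also have "(\<Sum>d=1..2*n. mangoldt d * real (2*n div d)) - 2 * \<dots> = ln (fact (2*n)) - 2 * ln (fact n)"
    by (simp only: ln_fact_eq_sum_mangoldt)
  also have "\<dots> = ln (real (2 * n choose n))"
    by (simp add: binomial_fact ln_div ln_mult)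
  also have "\<dots> \<le> ln (2 ^ (2 * n))"
  proof -
    have "2 * n choose n \<le> 2 ^ (2 * n)" by (rule binomial_le_pow2)
    then have "real (2 * n choose n) \<le> 2 ^ (2 * n)"
      by (metis of_nat_le_iff of_nat_numeral of_nat_power)
    then show ?thesis by (subst ln_le_cancel_iff) (auto simp: zero_less_binomial)
  qed
  finally show ?thesis by (simp add: ln_realpow)
qed

lemma chebyshev_psi_mono: "m \<le> n \<Longrightarrow> chebyshev_psi m \<le> chebyshev_psi n"
  unfolding chebyshev_psi_def by (intro sum_mono2) (auto simp: mangoldt_nonneg)

text \<open>Doubling from \<open>h\<close>, the half of \<open>N\<close> rounded up, costs
  \<open>2 * h * ln 2\<close>. The constant 6 absorbs the rounding:
  \<open>8 * h \<le> 4 * N + 4 \<le> 6 * N\<close> for \<open>N \<ge> 2\<close>.\<close>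

lemma chebyshev_psi_le: "chebyshev_psi N \<le> 6 * ln 2 * real N"
proof (induction N rule: less_induct)
  case (less N)
  show ?case
  proof (cases "N \<le> 1")
    case True
    then have "N = 0 \<or> N = 1" by auto
    then show ?thesis by (auto simp: chebyshev_psi_def)
  next
    case False
    define h where "h = (N + 1) div 2"
    have h: "h < N" "N \<le> 2 * h" "2 * h \<le> N + 1" using False by (auto simp: h_def)
    have "chebyshev_psi N \<le> chebyshev_psi (2 * h)" using h by (intro chebyshev_psi_mono)
    also have "\<dots> \<le> chebyshev_psi h + real (2 * h) * ln 2" using chebyshev_psi_double[of h] by simp
    also have "\<dots> \<le> 6 * ln 2 * real h + real (2 * h) * ln 2" using less.IH[of h] h by (intro add_right_mono) auto
    also have "\<dots> = (8 * real h) * ln 2" by simp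
    also have "\<dots> \<le> (6 * real N) * ln 2"
      using h False by (intro mult_right_mono) auto
    finally show ?thesis by (simp only: mult.commute mult.left_commute)
  qed
qed

lemma chebyshev_psi_le_6: "chebyshev_psi N \<le> 6 * real N"
proof -
  have "6 * ln 2 * real N \<le> 6 * 1 * real N"
    using ln_le_minus_one[of "2::real"] by (intro mult_right_mono mult_left_mono) auto
  with chebyshev_psi_le[of N] show ?thesis by simp
qed

text \<open>Lower half of Mertens' estimate: dropping the floor in Legendre's formula only increases
  the sum.\<close>

lemma sum_mangoldt_over_ge:
  assumes "N > 0" shows "(\<Sum>d=1..N. mangoldt d / real d) \<ge> ln (real N) - 1"
proof -
  have "real N * ln (real N) - real N \<le> (\<Sum>d=1..N. mangoldt d * real (N div d))"
    using ln_fact_ge by (simp only: ln_fact_eq_sum_mangoldt)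
  also have "\<dots> \<le> (\<Sum>d=1..N. mangoldt d * (real N / real d))"
    by (intro sum_mono mult_left_mono mangoldt_nonneg of_nat_div_le_of_nat)
  also have "\<dots> = real N * (\<Sum>d=1..N. mangoldt d / real d)"
    by (simp add: sum_distrib_left field_simps)
  finally have "real N * (ln (real N) - 1) \<le> real N * (\<Sum>d=1..N. mangoldt d / real d)"
    by (simp add: algebra_simps)
  then show ?thesis using assms by simp
qed

text \<open>Upper half: restoring the floor costs at most \<open>mangoldt d\<close> for each
  \<open>d\<close>, hence \<open>chebyshev_psi N\<close> in total, which is where Chebyshev's linear
  bound enters.\<close>

lemma sum_mangoldt_over_le:
  assumes "N > 0" shows "(\<Sum>d=1..N. mangoldt d / real d) \<le> ln (real N) + 6"
proof -
  have "real N * (\<Sum>d=1..N. mangoldt d / real d) = (\<Sum>d=1..N. mangoldt d * (real N / real d))"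
    by (simp add: sum_distrib_left field_simps)
  also have "\<dots> \<le> (\<Sum>d=1..N. mangoldt d * real (N div d) + mangoldt d)"
  proof (intro sum_mono)
    fix d assume "d \<in> {1..N}"
    have "real N / real d \<le> real (N div d) + 1"
      using real_divide_less_div_add_1[of N d] by linarith
    then have "mangoldt d * (real N / real d) \<le> mangoldt d * (real (N div d) + 1)"
      by (intro mult_left_mono mangoldt_nonneg)
    then show "mangoldt d * (real N / real d) \<le> mangoldt d * real (N div d) + mangoldt d"
      by (simp add: algebra_simps)
  qed
  also have "\<dots> = ln (fact N) + chebyshev_psi N"
    by (simp only: sum.distrib chebyshev_psi_def ln_fact_eq_sum_mangoldt)
  also have "\<dots> \<le> real N * (ln (real N) + 6)"
    using ln_fact_le[of N] chebyshev_psi_le_6[of N] by (simp add: algebra_simps)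
  finally show ?thesis using assms by simp
qed

section \<open>The Moebius function and inversion\<close>

definition moebius :: "nat \<Rightarrow> real" where
  "moebius n = (if squarefree n then (-1) ^ card (prime_factors n) else 0)"

lemma abs_moebius_le: "\<bar>moebius n\<bar> \<le> 1"
  by (simp add: moebius_def)

lemma moebius_mult_prime:
  assumes "prime p" "\<not> p dvd n"
  shows "moebius (p * n) = - moebius n"
proof (cases "squarefree n")
  case True
  have c: "coprime p n" using assms by (simp add: prime_imp_coprime)
  have n: "n > 0" using True by (auto intro!: Nat.gr0I)
  have "squarefree (p * n)"
    using True assms c by (simp add: squarefree_mult_coprime squarefree_prime)
  moreover have "prime_factors (p * n) = insert p (prime_factors n)"
    using assms n by (simp add: prime_factors_product prime_prime_factors)
  moreover have "p \<notin> prime_factors n" using assms by auto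
  ultimately show ?thesis using True by (simp add: moebius_def)
next
  case False
  then have "\<not> squarefree (p * n)" by (meson dvd_triv_right squarefree_mono)
  with False show ?thesis by (simp add: moebius_def)
qed

text \<open>Only squarefree divisors count. For a fixed prime \<open>p\<close> dividing
  \<open>n\<close>, multiplication by \<open>p\<close> pairs those not divisible by \<open>p\<close>
  with those divisible by it, and the signs in each pair are opposite.\<close>

lemma sum_moebius_divisors:
  assumes "n > 0"
  shows "(\<Sum>d | d dvd n. moebius d) = (if n = 1 then 1 else 0)"
proof (cases "n = 1")
  case False
  then obtain p where p: "prime p" "p dvd n" using prime_factor_nat by blast
  define S where "S = {d. d dvd n \<and> squarefree d \<and> \<not> p dvd d}"
  have fin: "finite S" unfolding S_def
    by (rule finite_subset[OF _ finite_divisors_nat[OF assms]]) auto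
  have "(\<Sum>d | d dvd n. moebius d) = (\<Sum>d\<in>S \<union> (*) p ` S. moebius d)"
  proof (rule sum.mono_neutral_right)
    show "finite {d. d dvd n}" using finite_divisors_nat[OF assms] .
    show "S \<union> (*) p ` S \<subseteq> {d. d dvd n}"
      using p by (auto simp: S_def prime_imp_coprime intro!: divides_mult)
    show "\<forall>d\<in>{d. d dvd n} - (S \<union> (*) p ` S). moebius d = 0"
    proof
      fix d assume d: "d \<in> {d. d dvd n} - (S \<union> (*) p ` S)"
      show "moebius d = 0"
      proof (rule ccontr)
        assume "moebius d \<noteq> 0"
        then have sf: "squarefree d" by (auto simp: moebius_def split: if_splits)
        with d have "p dvd d" by (auto simp: S_def)
        then obtain e where e: "d = p * e" by (elim dvdE)
        have "\<not> p dvd e"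
        proof
          assume "p dvd e"
          then have "p ^ 2 dvd d" by (auto simp: e power2_eq_square)
          with sf have "is_unit p" by (auto simp: squarefree_def)
          with p show False by auto
        qed
        moreover have "squarefree e" using sf e by (meson dvd_triv_right squarefree_mono)
        ultimately have "e \<in> S" using d e by (auto simp: S_def dest: dvd_mult_right)
        with d e show False by auto
      qed
    qed
  qed
  also have "\<dots> = (\<Sum>d\<in>S. moebius d) + (\<Sum>d\<in>(*) p ` S. moebius d)"
    using fin by (intro sum.union_disjoint) (auto simp: S_def)
  also have "(\<Sum>d\<in>(*) p ` S. moebius d) = (\<Sum>d\<in>S. moebius (p * d))"
    using p by (subst sum.reindex) (auto simp: inj_on_def)
  also have "\<dots> = (\<Sum>d\<in>S. - moebius d)"
    using p by (intro sum.cong) (auto simp: S_def moebius_mult_prime)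
  finally show ?thesis using False by (simp add: sum_negf)
qed (auto simp: moebius_def)

text \<open>Moebius inversion of \<open>mangoldt_sum\<close>: expand \<open>ln (n / d)\<close> as a
  sum over divisors \<open>e\<close> of \<open>n / d\<close> and exchange the sums; the inner sum of
  \<open>moebius\<close> then survives only at \<open>e = n\<close>.\<close>

lemma sum_moebius_ln:
  assumes n: "n > 0"
  shows "(\<Sum>d | d dvd n. moebius d * ln (real n / real d)) = mangoldt n"
proof -
  have fin: "finite {d. d dvd n}" using n by simp
  have "(\<Sum>d | d dvd n. moebius d * ln (real n / real d))
      = (\<Sum>d | d dvd n. \<Sum>e | e dvd n \<and> d * e dvd n. moebius d * mangoldt e)"
  proof (intro sum.cong refl)
    fix d assume "d \<in> {d. d dvd n}"
    then obtain k where k: "n = d * k" by auto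
    with n have pos: "d > 0" "k > 0" by auto
    have "ln (real n / real d) = ln (real k)" using pos k by simp
    also have "\<dots> = (\<Sum>e | e dvd k. mangoldt e)"
      using mangoldt_sum[of k, where ?'a = real] pos by simp
    \<comment> \<open>This describes the pairs by a condition symmetric in \<open>d\<close> and
      \<open>e\<close>, as the exchange of the two sums requires.\<close>
    also have "{e. e dvd k} = {e. e dvd n \<and> d * e dvd n}" using pos by (auto simp: k)
    finally show "moebius d * ln (real n / real d) = (\<Sum>e | e dvd n \<and> d * e dvd n. moebius d * mangoldt e)"
      by (simp add: sum_distrib_left)
  qed
  also have "\<dots> = (\<Sum>e | e dvd n. \<Sum>d | d dvd n \<and> d * e dvd n. moebius d * mangoldt e)"
    using sum.swap_restrict[OF fin fin, of "\<lambda>d e. moebius d * mangoldt e" "\<lambda>d e. d * e dvd n"] by simp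
  also have "\<dots> = (\<Sum>e | e dvd n. if e = n then mangoldt e else 0)"
  proof (intro sum.cong refl)
    fix e assume "e \<in> {e. e dvd n}"
    then obtain k where "n = e * k" by auto
    then have k: "n = k * e" by simp
    with n have pos: "e > 0" "k > 0" by auto
    have "{d. d dvd n \<and> d * e dvd n} = {d. d dvd k}" using pos by (auto simp: k)
    then have "(\<Sum>d | d dvd n \<and> d * e dvd n. moebius d * mangoldt e) = (\<Sum>d | d dvd k. moebius d) * mangoldt e"
      by (simp add: sum_distrib_right)
    then show "(\<Sum>d | d dvd n \<and> d * e dvd n. moebius d * mangoldt e) = (if e = n then mangoldt e else 0)"
      using pos k by (auto simp: sum_moebius_divisors)
  qed
  also have "\<dots> = mangoldt n" using fin by simp
  finally show ?thesis .
qed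

section \<open>Dirichlet characters\<close>

text \<open>Characters are functions on all natural numbers, so that no group of units has to be
  formed. The last condition excludes the zero function and thereby forces the value 1 at 1.\<close>

definition dirichlet_chars :: "nat \<Rightarrow> (nat \<Rightarrow> complex) set" where
  "dirichlet_chars q = {\<chi>. (\<forall>m n. \<chi> (m * n) = \<chi> m * \<chi> n) \<and> (\<forall>n. \<chi> (n mod q) = \<chi> n) \<and>
     (\<forall>n. \<chi> n = 0 \<longleftrightarrow> \<not> coprime n q)}"

definition principal_char :: "nat \<Rightarrow> nat \<Rightarrow> complex" where
  "principal_char q n = of_bool (coprime n q)"

lemma
  assumes "\<chi> \<in> dirichlet_chars q"
  shows dirichlet_char_mult: "\<chi> (m * n) = \<chi> m * \<chi> n"
    and dirichlet_char_mod: "\<chi> (n mod q) = \<chi> n"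
    and dirichlet_char_eq_0_iff: "\<chi> n = 0 \<longleftrightarrow> \<not> coprime n q"
  using assms by (auto simp: dirichlet_chars_def)

lemma dirichlet_char_1:
  assumes "\<chi> \<in> dirichlet_chars q"
  shows "\<chi> 1 = 1"
proof -
  have "\<chi> 1 = \<chi> 1 * \<chi> 1" using dirichlet_char_mult[OF assms, of 1 1] by simp
  moreover have "\<chi> 1 \<noteq> 0" using dirichlet_char_eq_0_iff[OF assms, of 1] by simp
  ultimately show ?thesis by simp
qed

lemma dirichlet_char_cong:
  assumes "\<chi> \<in> dirichlet_chars q" "[m = n] (mod q)"
  shows "\<chi> m = \<chi> n"
  using assms dirichlet_char_mod[OF assms(1)] by (metis cong_def)

lemma dirichlet_char_power:
  assumes "\<chi> \<in> dirichlet_chars q"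
  shows "\<chi> (n ^ k) = \<chi> n ^ k"
  using dirichlet_char_1[OF assms] by (induction k) (auto simp: dirichlet_char_mult[OF assms])

lemma dirichlet_char_power_totient:
  assumes "\<chi> \<in> dirichlet_chars q" "coprime n q"
  shows "\<chi> n ^ totient q = 1"
  using dirichlet_char_cong[OF assms(1) euler_theorem[OF assms(2)]] dirichlet_char_1[OF assms(1)]
  by (simp add: dirichlet_char_power[OF assms(1)])

lemma norm_dirichlet_char:
  assumes "\<chi> \<in> dirichlet_chars q" "coprime n q" "q > 0"
  shows "norm (\<chi> n) = 1"
proof -
  have "norm (\<chi> n) ^ totient q = 1"
    using dirichlet_char_power_totient[OF assms(1,2)] by (metis norm_one norm_power)
  then show ?thesis
    using assms(3) power_eq_imp_eq_base[of "norm (\<chi> n)" "totient q" 1] by simp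
qed

lemma norm_dirichlet_char_le:
  assumes "\<chi> \<in> dirichlet_chars q" "q > 0"
  shows "norm (\<chi> n) \<le> 1"
  using norm_dirichlet_char[OF assms(1) _ assms(2), of n] dirichlet_char_eq_0_iff[OF assms(1), of n]
  by (cases "coprime n q") auto

lemma dirichlet_char_mult_cnj:
  assumes "\<chi> \<in> dirichlet_chars q" "coprime n q" "q > 0"
  shows "\<chi> n * cnj (\<chi> n) = 1"
  using norm_dirichlet_char[OF assms] by (simp add: complex_norm_square[symmetric])

lemma principal_char_in: "principal_char q \<in> dirichlet_chars q"
proof -
  have "coprime (n mod q) q \<longleftrightarrow> coprime n q" for n by (cases "q = 0") auto
  then show ?thesis by (auto simp: dirichlet_chars_def principal_char_def)
qed

lemma dirichlet_chars_times:
  assumes "\<chi> \<in> dirichlet_chars q" "\<psi> \<in> dirichlet_chars q"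
  shows "(\<lambda>n. \<chi> n * \<psi> n) \<in> dirichlet_chars q"
  using assms by (auto simp: dirichlet_chars_def)

lemma dirichlet_chars_cnj:
  assumes "\<chi> \<in> dirichlet_chars q"
  shows "(\<lambda>n. cnj (\<chi> n)) \<in> dirichlet_chars q"
  using assms by (auto simp: dirichlet_chars_def)

text \<open>A character is determined by its values on \<open>{..<q}\<close>, and these are 0 or
  roots of unity of order dividing \<open>totient q\<close>.\<close>

lemma finite_dirichlet_chars:
  assumes q: "q > 0"
  shows "finite (dirichlet_chars q)"
proof -
  define R where "R = insert 0 {z :: complex. z ^ totient q = 1}"
  have fin: "finite ({..<q} \<rightarrow>\<^sub>E R)"
    using q finite_roots_unity[of "totient q"] by (intro finite_PiE) (auto simp: R_def Suc_le_eq)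
  have "(\<lambda>\<chi>. restrict \<chi> {..<q}) ` dirichlet_chars q \<subseteq> {..<q} \<rightarrow>\<^sub>E R"
  proof (intro image_subsetI restrict_PiE_iff[THEN iffD2] ballI)
    fix \<chi> n assume "\<chi> \<in> dirichlet_chars q"
    then show "\<chi> n \<in> R"
      using dirichlet_char_power_totient[of \<chi> q n] dirichlet_char_eq_0_iff[of \<chi> q n] by (auto simp: R_def)
  qed
  moreover have "inj_on (\<lambda>\<chi>. restrict \<chi> {..<q}) (dirichlet_chars q)"
  proof (rule inj_onI, rule ext)
    fix \<chi> \<psi> n
    assume *: "\<chi> \<in> dirichlet_chars q" "\<psi> \<in> dirichlet_chars q" "restrict \<chi> {..<q} = restrict \<psi> {..<q}"
    have "n mod q < q" using q by simp
    then have "\<chi> (n mod q) = \<psi> (n mod q)" using *(3) by (metis lessThan_iff restrict_apply)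
    then show "\<chi> n = \<psi> n" using * dirichlet_char_mod by metis
  qed
  ultimately show ?thesis using fin by (metis finite_imageD finite_subset)
qed

text \<open>If \<open>\<chi> a \<noteq> 1\<close> with \<open>a\<close> coprime to \<open>q\<close>,
  multiplication by \<open>a\<close> permutes the residues, so the sum equals
  \<open>\<chi> a\<close> times itself.\<close>

lemma sum_dirichlet_char_period:
  assumes \<chi>: "\<chi> \<in> dirichlet_chars q" "\<chi> \<noteq> principal_char q" and q: "q > 0"
  shows "(\<Sum>n<q. \<chi> n) = 0"
proof -
  obtain a where a: "\<chi> a \<noteq> principal_char q a" using \<chi>(2) by auto
  then have cop: "coprime a q"
    using dirichlet_char_eq_0_iff[OF \<chi>(1), of a] by (auto simp: principal_char_def split: if_splits)
  then have a1: "\<chi> a \<noteq> 1" using a by (simp add: principal_char_def)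
  have inj: "inj_on (\<lambda>n. a * n mod q) {..<q}"
  proof (rule inj_onI)
    fix x y assume *: "x \<in> {..<q}" "y \<in> {..<q}" "a * x mod q = a * y mod q"
    then have "[a * x = a * y] (mod q)" by (simp add: cong_def)
    then have "[x = y] (mod q)" using cop by (simp add: cong_mult_lcancel_nat)
    then show "x = y" using * by (simp add: cong_def)
  qed
  have surj: "(\<lambda>n. a * n mod q) ` {..<q} = {..<q}"
    using q by (intro endo_inj_surj inj) auto
  have "(\<Sum>n<q. \<chi> n) = (\<Sum>n<q. \<chi> (a * n mod q))"
    using sum.reindex[OF inj, of \<chi>] surj by simp
  also have "\<dots> = \<chi> a * (\<Sum>n<q. \<chi> n)"
    by (simp add: dirichlet_char_mod[OF \<chi>(1)] dirichlet_char_mult[OF \<chi>(1)] sum_distrib_left)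
  finally have "(1 - \<chi> a) * (\<Sum>n<q. \<chi> n) = 0" by (simp add: algebra_simps)
  then show ?thesis using a1 by simp
qed

text \<open>Complete periods cancel, and the incomplete one has fewer than \<open>q\<close> terms of
  norm at most 1.\<close>

lemma norm_sum_dirichlet_char_le:
  assumes \<chi>: "\<chi> \<in> dirichlet_chars q" "\<chi> \<noteq> principal_char q" and q: "q > 0"
  shows "norm (\<Sum>n<M. \<chi> n) \<le> real q"
proof -
  have 0: "(\<Sum>n<q*k. \<chi> n) = 0" for k
  proof (induction k)
    case (Suc k)
    have "(\<Sum>n<q * Suc k. \<chi> n) = (\<Sum>n<q*k. \<chi> n) + (\<Sum>n=q*k..<q*k+q. \<chi> n)"
      by (subst sum.atLeastLessThan_concat[of 0 _ _, symmetric, simplified lessThan_atLeast0[symmetric]])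
         (auto simp: lessThan_atLeast0 sum.atLeastLessThan_concat add.commute)
    also have "(\<Sum>n=q*k..<q*k+q. \<chi> n) = (\<Sum>n<q. \<chi> (n + q * k))"
      using sum.shift_bounds_nat_ivl[of \<chi> 0 "q*k" q] by (simp add: lessThan_atLeast0 add.commute)
    also have "\<dots> = (\<Sum>n<q. \<chi> n)"
      by (intro sum.cong refl dirichlet_char_cong[OF \<chi>(1)]) (simp add: cong_def)
    finally show ?case using Suc sum_dirichlet_char_period[OF assms] by simp
  qed auto
  define k where "k = M div q"
  have M: "q * k \<le> M" "M < q * k + q" using q unfolding k_def
    by (simp_all add: dividend_less_times_div add.commute)
  have "(\<Sum>n<M. \<chi> n) = (\<Sum>n<q*k. \<chi> n) + (\<Sum>n=q*k..<M. \<chi> n)"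
    using M(1) by (simp add: lessThan_atLeast0 sum.atLeastLessThan_concat)
  then have "norm (\<Sum>n<M. \<chi> n) = norm (\<Sum>n=q*k..<M. \<chi> n)" by (simp add: 0)
  also have "\<dots> \<le> (\<Sum>n=q*k..<M. 1)"
    by (intro sum_norm_le norm_dirichlet_char_le[OF \<chi>(1) q])
  also have "\<dots> = real (M - q * k)" by simp
  also have "\<dots> \<le> real q" using M by (intro of_nat_mono) linarith
  finally show ?thesis .
qed

text \<open>The dual of the cancellation over a period: multiplication by \<open>\<psi>\<close>
  permutes the characters, with multiplication by the conjugate as its inverse.\<close>

lemma sum_dirichlet_chars_eq_0:
  assumes q: "q > 0" and \<psi>: "\<psi> \<in> dirichlet_chars q" "\<psi> a \<noteq> 1"
  shows "(\<Sum>\<chi>\<in>dirichlet_chars q. \<chi> a) = 0"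
proof -
  have "(\<Sum>\<chi>\<in>dirichlet_chars q. \<chi> a) = (\<Sum>\<chi>\<in>dirichlet_chars q. \<psi> a * \<chi> a)"
  proof (rule sum.reindex_bij_witness
      [where j = "\<lambda>\<chi> n. cnj (\<psi> n) * \<chi> n" and i = "\<lambda>\<chi> n. \<psi> n * \<chi> n"])
    \<comment> \<open>The conjugate inverts \<open>\<psi>\<close> only at arguments coprime to
      \<open>q\<close>; at the others \<open>\<chi>\<close> vanishes.\<close>
    have *: "\<psi> n * (cnj (\<psi> n) * \<chi> n) = \<chi> n" if "\<chi> \<in> dirichlet_chars q" for \<chi> n
      using dirichlet_char_mult_cnj[OF \<psi>(1) _ q, of n] dirichlet_char_eq_0_iff[OF that, of n]
      by (cases "coprime n q") (auto simp: mult.assoc[symmetric])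
    fix \<chi> assume \<chi>: "\<chi> \<in> dirichlet_chars q"
    show "(\<lambda>n. \<psi> n * (cnj (\<psi> n) * \<chi> n)) = \<chi>" using *[OF \<chi>] by auto
    show "\<psi> a * (cnj (\<psi> a) * \<chi> a) = \<chi> a" using *[OF \<chi>] .
    show "(\<lambda>n. cnj (\<psi> n) * \<chi> n) \<in> dirichlet_chars q" "(\<lambda>n. \<psi> n * \<chi> n) \<in> dirichlet_chars q"
      using \<chi> \<psi>(1) by (auto intro!: dirichlet_chars_times dirichlet_chars_cnj)
    show "(\<lambda>n. cnj (\<psi> n) * (\<psi> n * \<chi> n)) = \<chi>" using *[OF \<chi>] by (auto simp: mult_ac)
  qed
  also have "\<dots> = \<psi> a * (\<Sum>\<chi>\<in>dirichlet_chars q. \<chi> a)" by (simp add: sum_distrib_left)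
  finally have "(1 - \<psi> a) * (\<Sum>\<chi>\<in>dirichlet_chars q. \<chi> a) = 0" by (simp add: algebra_simps)
  then show ?thesis using \<psi>(2) by simp
qed

text \<open>No prime divides \<open>q\<close> more than once. This reduces the separation of
  residues by characters to prime moduli, and is the reason for restricting Dirichlet's theorem to
  squarefree moduli.\<close>

lemma squarefree_dvdI:
  fixes q x :: nat
  assumes "squarefree q" "\<And>p. prime p \<Longrightarrow> p dvd q \<Longrightarrow> p dvd x"
  shows "q dvd x"
proof (cases "x = 0")
  case False
  have q0: "q \<noteq> 0" using assms(1) by (cases "q = 0") auto
  show ?thesis
  proof (rule multiplicity_le_imp_dvd)
    fix p :: nat assume p: "prime p"
    show "multiplicity p q \<le> multiplicity p x"
    proof (cases "p dvd q")
      case True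
      then have "multiplicity p q \<le> 1"
        using assms(1) p q0 by (auto simp: squarefree_factorial_semiring'')
      also have "1 \<le> multiplicity p x"
        using assms(2)[OF p True] p False by (simp add: Suc_le_eq prime_multiplicity_gt_zero_iff)
      finally show ?thesis .
    qed (simp add: not_dvd_imp_multiplicity_0)
  qed (use q0 in auto)
qed auto

text \<open>With \<open>g\<close> a primitive root modulo \<open>p\<close>, sending
  \<open>g ^ i\<close> to the \<open>i\<close>-th power of a primitive root of unity of order
  \<open>p - 1\<close> is injective on the units modulo \<open>p\<close>. Since \<open>p\<close>
  divides \<open>q\<close>, it induces a character modulo \<open>q\<close>.\<close>

lemma exists_dirichlet_char_neq_1_prime:
  assumes p: "prime p" and q: "p dvd q" and a: "coprime a q" "\<not> [a = 1] (mod p)"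
  shows "\<exists>\<chi>\<in>dirichlet_chars q. \<chi> a \<noteq> 1"
proof -
  obtain g where g: "residue_primroot p g" using prime_primitive_root_exists p prime_gt_1_nat by blast
  have p1: "p > 1" using p prime_gt_1_nat by simp
  define k where "k = p - 1"
  have k: "k > 0" using p1 by (simp add: k_def)
  have ord: "ord p g = k" and copg: "coprime p g"
    using g p by (auto simp: residue_primroot_def totient_prime k_def)
  have "\<forall>n. \<exists>i. coprime n q \<longrightarrow> [g ^ i = n] (mod p)"
  proof
    fix n
    show "\<exists>i. coprime n q \<longrightarrow> [g ^ i = n] (mod p)"
    proof (cases "coprime n q")
      case True
      then have "coprime n p" using q by (meson coprime_imp_coprime dvd_trans dvd_refl)
      then have "n mod p \<in> totatives p"
        using p1 by (auto simp: totatives_def intro!: Nat.gr0I)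
      then have "n mod p \<in> (\<lambda>i. g ^ i mod p) ` {..<totient p}"
        using residue_primroot_is_generator[OF p1 g] by (simp add: bij_betw_def)
      then show ?thesis by (auto simp: cong_def)
    qed auto
  qed
  \<comment> \<open>The index is an arbitrary choice and is determined only modulo \<open>k\<close>;
    hence the congruences modulo \<open>k\<close> that follow.\<close>
  then obtain ind where ind: "\<And>n. coprime n q \<Longrightarrow> [g ^ ind n = n] (mod p)" by metis
  have indI: "[i = j] (mod k)" if "[g ^ i = g ^ j] (mod p)" for i j
    using that order_divides_expdiff[OF copg, of i j] ord by simp
  define w where "w = cis (2 * pi / real k)"
  have w_pow: "w ^ i = cis (2 * pi * real i / real k)" for i
    unfolding w_def by (simp add: DeMoivre mult_ac)
  have wk: "w ^ k = 1" using k by (simp add: w_pow)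
  have w_mod: "w ^ (i mod k) = w ^ i" for i
  proof -
    have "w ^ i = (w ^ k) ^ (i div k) * w ^ (i mod k)"
      by (metis mult_div_mod_eq power_add power_mult)
    then show ?thesis by (simp add: wk)
  qed
  have w_cong: "w ^ i = w ^ j" if "[i = j] (mod k)" for i j
    using that w_mod by (metis cong_def)
  \<comment> \<open>\<open>w\<close> is a primitive \<open>k\<close>-th root of unity: its powers
    with exponents below \<open>k\<close> are distinct.\<close>
  have w_1: "[i = 0] (mod k)" if "w ^ i = 1" for i
  proof -
    have "inj_on (\<lambda>i. cis (2 * pi * real i / real k)) {..<k}"
      using bij_betw_roots_unity[OF k] by (auto simp: bij_betw_def)
    moreover have "w ^ (i mod k) = w ^ 0" using that by (simp add: w_mod)
    ultimately have "i mod k = 0" using k by (auto simp: inj_on_def w_pow)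
    then show ?thesis by (simp add: cong_def)
  qed
  define \<chi> where "\<chi> = (\<lambda>n. if coprime n q then w ^ ind n else 0)"
  have "\<chi> \<in> dirichlet_chars q"
    unfolding dirichlet_chars_def mem_Collect_eq
  proof (intro conjI allI)
    fix m n
    show "\<chi> (m * n) = \<chi> m * \<chi> n"
    proof (cases "coprime m q \<and> coprime n q")
      case True
      then have "[g ^ ind (m * n) = m * n] (mod p)" by (intro ind) auto
      moreover have "[g ^ (ind m + ind n) = m * n] (mod p)"
        unfolding power_add using True by (intro cong_mult ind) auto
      ultimately have "[ind (m * n) = ind m + ind n] (mod k)"
        by (intro indI) (metis cong_sym cong_trans)
      then have "w ^ ind (m * n) = w ^ (ind m + ind n)" by (rule w_cong)
      then show ?thesis using True by (simp add: \<chi>_def power_add)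
    qed (auto simp: \<chi>_def)
  next
    fix n
    have cop_iff: "coprime (n mod q) q \<longleftrightarrow> coprime n q"
      by (cases "q = 0") auto
    show "\<chi> (n mod q) = \<chi> n"
    proof (cases "coprime n q")
      case True
      have "[n mod q = n] (mod q)" by simp
      then have "[n mod q = n] (mod p)" using q cong_dvd_modulus_nat by blast
      then have "[g ^ ind (n mod q) = g ^ ind n] (mod p)"
        using ind[of n] ind[of "n mod q"] True cop_iff by (metis cong_sym cong_trans)
      then show ?thesis using True cop_iff w_cong indI by (auto simp: \<chi>_def)
    qed (simp add: \<chi>_def cop_iff)
  next
    fix n
    show "\<chi> n = 0 \<longleftrightarrow> \<not> coprime n q" by (auto simp: \<chi>_def w_def)
  qed
  moreover have "\<chi> a \<noteq> 1"
  proof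
    assume "\<chi> a = 1"
    then have "[ind a = 0] (mod k)" using a(1) by (intro w_1) (simp add: \<chi>_def)
    then have "[g ^ ind a = g ^ 0] (mod p)"
      using order_divides_expdiff[OF copg, of "ind a" 0] ord by simp
    then have "[a = 1] (mod p)" using ind[OF a(1)] by (metis cong_sym cong_trans power_0)
    with a(2) show False by simp
  qed
  ultimately show ?thesis by blast
qed

lemma exists_dirichlet_char_neq_1:
  assumes q: "squarefree q" and a: "coprime a q" "\<not> [a = 1] (mod q)"
  shows "\<exists>\<chi>\<in>dirichlet_chars q. \<chi> a \<noteq> 1"
\<comment> \<open>Coprimality of 0 with \<open>q\<close> forces \<open>q = 1\<close>, where all
  numbers are congruent. Otherwise \<open>a - 1\<close> is a genuine difference and the congruence
  becomes a divisibility.\<close>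
proof (cases "a = 0")
  case True
  with a show ?thesis by simp
next
  case False
  then have cong_iff: "[a = 1] (mod m) \<longleftrightarrow> m dvd a - 1" for m
    using cong_altdef_nat[of 1 a m] by simp
  have "\<not> q dvd a - 1" using a(2) cong_iff by simp
  then obtain p where "prime p" "p dvd q" "\<not> p dvd a - 1" using squarefree_dvdI[OF q] by blast
  then show ?thesis using exists_dirichlet_char_neq_1_prime[of p q a] a(1) cong_iff by simp
qed

text \<open>Orthogonality. Dividing \<open>n\<close> by \<open>a\<close> modulo \<open>q\<close>
  reduces the sum to one over the values at a single residue, which vanishes as soon as some
  character separates that residue from 1.\<close>

lemma sum_dirichlet_chars:
  assumes q: "squarefree q" and a: "coprime a q"
  shows "(\<Sum>\<chi>\<in>dirichlet_chars q. cnj (\<chi> a) * \<chi> n)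
    = (if [n = a] (mod q) then of_nat (card (dirichlet_chars q)) else 0)"
proof -
  have q0: "q > 0" using q by (cases "q = 0") auto
  show ?thesis
  proof (cases "coprime n q")
    case False
    then have "\<not> [n = a] (mod q)" using a by (metis cong_imp_coprime cong_sym coprime_commute)
    then show ?thesis using False by (auto intro!: sum.neutral simp: dirichlet_char_eq_0_iff)
  next
    case cop: True
    \<comment> \<open>By Euler's theorem the power of \<open>a\<close> is an inverse of
      \<open>a\<close> modulo \<open>q\<close>, so \<open>b\<close> represents
      \<open>n / a\<close>.\<close>
    define b where "b = a ^ (totient q - 1) * n"
    have ab: "[a * b = n] (mod q)"
    proof -
      have "a * a ^ (totient q - 1) = a ^ totient q" using q0 by (cases "totient q") auto
      then have "a * b = a ^ totient q * n" by (simp add: b_def)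
      then show ?thesis using cong_mult[OF euler_theorem[OF a] cong_refl[of n]] by simp
    qed
    have "coprime b q" unfolding b_def using a cop by simp
    have b_iff: "[b = 1] (mod q) \<longleftrightarrow> [n = a] (mod q)"
    proof -
      have "[b = 1] (mod q) \<longleftrightarrow> [a * b = a * 1] (mod q)" using cong_mult_lcancel_nat[of a q b 1] a by simp
      also have "\<dots> \<longleftrightarrow> [n = a] (mod q)" using ab by (metis cong_sym cong_trans mult.right_neutral)
      finally show ?thesis .
    qed
    have "cnj (\<chi> a) * \<chi> n = \<chi> b" if "\<chi> \<in> dirichlet_chars q" for \<chi>
    proof -
      have "\<chi> n = \<chi> a * \<chi> b" using dirichlet_char_cong[OF that ab] dirichlet_char_mult[OF that] by simp
      then show ?thesis using dirichlet_char_mult_cnj[OF that a q0]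
        by (metis mult.assoc mult.commute mult_1)
    qed
    then have *: "(\<Sum>\<chi>\<in>dirichlet_chars q. cnj (\<chi> a) * \<chi> n) = (\<Sum>\<chi>\<in>dirichlet_chars q. \<chi> b)" by simp
    show ?thesis
    proof (cases "[b = 1] (mod q)")
      case True
      then have "(\<Sum>\<chi>\<in>dirichlet_chars q. \<chi> b) = (\<Sum>\<chi>\<in>dirichlet_chars q. 1)"
        by (intro sum.cong refl) (use dirichlet_char_cong dirichlet_char_1 in metis)
      then show ?thesis using * True b_iff by simp
    next
      case False
      then obtain \<psi> where "\<psi> \<in> dirichlet_chars q" "\<psi> b \<noteq> 1"
        using exists_dirichlet_char_neq_1[OF q \<open>coprime b q\<close>] by blast
      then show ?thesis using * False b_iff sum_dirichlet_chars_eq_0[OF q0] by simp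
    qed
  qed
qed

section \<open>The values $L(1,\chi)$ and sums of $\chi\Lambda$\<close>

text \<open>Abel summation: the two boundary terms give \<open>g M * B\<close> and
  \<open>g m * B\<close>, and the differences of \<open>g\<close> telescope to
  \<open>(g m - g M) * B\<close>.\<close>

lemma norm_sum_antimono_le:
  fixes a :: "nat \<Rightarrow> complex" and g :: "nat \<Rightarrow> real"
  assumes bound: "\<And>k. norm (\<Sum>n<k. a n) \<le> B"
    and anti: "\<And>k. k \<ge> m \<Longrightarrow> g (Suc k) \<le> g k" and nonneg: "\<And>k. k \<ge> m \<Longrightarrow> g k \<ge> 0"
    and M: "m \<le> M"
  shows "norm (\<Sum>n=m..<M. of_real (g n) * a n) \<le> 2 * B * g m"
proof -
  define S where "S = (\<lambda>k. \<Sum>n<k. a n)"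
  have nS: "norm (S k) \<le> B" for k unfolding S_def by (rule bound)
  have "norm (of_real c * S k) \<le> c * B" if "c \<ge> 0" for c k
    using nS[of k] that by (simp add: norm_mult mult_left_mono)
  note le = this
  have parts: "(\<Sum>n=m..<M. of_real (g n) * a n)
     = of_real (g M) * S M - of_real (g m) * S m + (\<Sum>n=m..<M. of_real (g n - g (Suc n)) * S (Suc n))"
    using M by (induction rule: dec_induct) (auto simp: S_def algebra_simps)
  have "norm (\<Sum>n=m..<M. of_real (g n - g (Suc n)) * S (Suc n)) \<le> (\<Sum>n=m..<M. (g n - g (Suc n)) * B)"
    using anti by (intro sum_norm_le le) auto
  also have "\<dots> = (g m - g M) * B"
    using sum_Suc_diff'[OF M, of g] by (simp add: sum_distrib_right[symmetric] sum_subtractf)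
  finally have "norm (\<Sum>n=m..<M. of_real (g n) * a n) \<le> g M * B + g m * B + (g m - g M) * B"
    unfolding parts using le[OF nonneg[OF M], of M] le[OF nonneg[OF order.refl], of m]
    by (intro norm_triangle_mono norm_triangle_le_diff) auto
  then show ?thesis by (simp add: algebra_simps)
qed

text \<open>The tail bound makes the sequence Cauchy, and letting \<open>N\<close> tend to infinity
  carries the bound over to the limit.\<close>

lemma convergent_with_rate:
  fixes S :: "nat \<Rightarrow> complex"
  assumes rate: "\<And>M N. M \<le> N \<Longrightarrow> norm (S N - S M) \<le> e M" and lim: "e \<longlonglongrightarrow> 0"
  shows "norm (S M - lim S) \<le> e M"
proof -
  have "Cauchy S"
  proof (rule metric_CauchyI)
    fix r :: real assume r: "r > 0"
    then have "eventually (\<lambda>n. e n < r / 2) sequentially"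
      using lim by (intro order_tendstoD(2)[OF lim]) auto
    then obtain M where M: "\<And>n. n \<ge> M \<Longrightarrow> e n < r / 2" by (auto simp: eventually_sequentially)
    have "dist (S m) (S n) < r" if "m \<ge> M" "n \<ge> M" for m n
      using dist_triangle_half_r[of "S M" "S m" r "S n"] rate[OF that(1)] rate[OF that(2)] M[of M]
      by (auto simp: dist_norm norm_minus_commute)
    then show "\<exists>M. \<forall>m\<ge>M. \<forall>n\<ge>M. dist (S m) (S n) < r" by blast
  qed
  then have "convergent S" by (rule Cauchy_convergent)
  then have "(\<lambda>N. norm (S N - S M)) \<longlonglongrightarrow> norm (lim S - S M)"
    by (intro tendsto_intros) (simp add: convergent_LIMSEQ_iff)
  then have "norm (lim S - S M) \<le> e M"
    by (rule Lim_bounded[where M = M]) (use rate in auto)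
  then show "norm (S M - lim S) \<le> e M" by (simp add: norm_minus_commute)
qed

text \<open>Dirichlet's test with an explicit error. Monotonicity is asked from 1 on because the
  intended weight \<open>1 / real k\<close> has the value 0 at 0.\<close>

lemma nonprincipal_sum_rate:
  assumes \<chi>: "\<chi> \<in> dirichlet_chars q" "\<chi> \<noteq> principal_char q" and q: "q > 0"
    and anti: "\<And>k. k \<ge> 1 \<Longrightarrow> g (Suc k) \<le> g k" and lim: "g \<longlonglongrightarrow> 0"
  shows "\<exists>L. \<forall>M. norm ((\<Sum>n=1..M. of_real (g n) * \<chi> n) - L) \<le> 2 * real q * g (Suc M)"
proof -
  define S where "S = (\<lambda>M. \<Sum>n=1..M. of_real (g n) * \<chi> n)"
  have nonneg: "g k \<ge> 0" if "k \<ge> 1" for k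
  proof (rule LIMSEQ_le_const2[OF lim])
    show "\<exists>N. \<forall>n\<ge>N. g n \<le> g k"
    proof (intro exI allI impI)
      fix n assume "k \<le> n"
      then show "g n \<le> g k"
        by (induction rule: dec_induct) (use anti that in \<open>auto intro: order.trans\<close>)
    qed
  qed
  have "norm (S M - lim S) \<le> 2 * real q * g (Suc M)" for M
  proof (rule convergent_with_rate)
    fix M N :: nat assume "M \<le> N"
    then have "{1..N} = {1..M} \<union> {Suc M..<Suc N}" by auto
    then have "S N - S M = (\<Sum>n=Suc M..<Suc N. of_real (g n) * \<chi> n)"
      unfolding S_def by (simp only:) (subst sum.union_disjoint, auto)
    also have "norm \<dots> \<le> 2 * real q * g (Suc M)"
      using norm_sum_dirichlet_char_le[OF \<chi> q] anti nonneg \<open>M \<le> N\<close>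
      by (intro norm_sum_antimono_le) auto
    finally show "norm (S N - S M) \<le> 2 * real q * g (Suc M)" .
  next
    show "(\<lambda>M. 2 * real q * g (Suc M)) \<longlonglongrightarrow> 0"
      using tendsto_mult_left[OF LIMSEQ_Suc[OF lim], of "2 * real q"] by simp
  qed
  then show ?thesis unfolding S_def by blast
qed

section \<open>The value at 1 and the sums of characters against \<open>mangoldt\<close>\<close>

definition dirichlet_L1 :: "(nat \<Rightarrow> complex) \<Rightarrow> complex" where
  "dirichlet_L1 \<chi> = lim (\<lambda>M. \<Sum>n=1..M. \<chi> n / of_nat n)"

text \<open>The rate, not just the convergence, is what keeps the error terms of the convolution
  sums bounded.\<close>

lemma dirichlet_L1_rate:
  assumes \<chi>: "\<chi> \<in> dirichlet_chars q" "\<chi> \<noteq> principal_char q" and q: "q > 0"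
  shows "norm ((\<Sum>n=1..M. \<chi> n / of_nat n) - dirichlet_L1 \<chi>) \<le> 2 * real q / real (Suc M)"
proof -
  have lim0: "(\<lambda>k. 1 / real k) \<longlonglongrightarrow> 0" by (rule lim_1_over_n)
  obtain L where L: "\<And>M. norm ((\<Sum>n=1..M. \<chi> n / of_nat n) - L) \<le> 2 * real q / real (Suc M)"
    using nonprincipal_sum_rate[OF \<chi> q _ lim0] by (auto simp: field_simps)
  have "(\<lambda>M. 2 * real q / real (Suc M)) \<longlonglongrightarrow> 0"
    using tendsto_mult_left[OF LIMSEQ_Suc[OF lim0], of "2 * real q"] by simp
  then have "(\<lambda>M. (\<Sum>n=1..M. \<chi> n / of_nat n) - L) \<longlonglongrightarrow> 0"
    by (rule tendsto_0_le[where K = 1]) (use L in auto)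
  then have "dirichlet_L1 \<chi> = L" unfolding dirichlet_L1_def by (intro limI) (simp add: LIM_zero_iff)
  then show ?thesis using L by simp
qed

lemma dirichlet_L1_tendsto:
  assumes \<chi>: "\<chi> \<in> dirichlet_chars q" "\<chi> \<noteq> principal_char q" and q: "q > 0"
  shows "(\<lambda>M. \<Sum>n=1..M. \<chi> n / of_nat n) \<longlonglongrightarrow> dirichlet_L1 \<chi>"
proof -
  have "(\<lambda>M. 2 * real q / real (Suc M)) \<longlonglongrightarrow> 0"
    using tendsto_mult_left[OF LIMSEQ_Suc[OF lim_1_over_n], of "2 * real q"] by simp
  then have "(\<lambda>M. (\<Sum>n=1..M. \<chi> n / of_nat n) - dirichlet_L1 \<chi>) \<longlonglongrightarrow> 0"
    by (rule tendsto_0_le[where K = 1]) (use dirichlet_L1_rate[OF assms] in auto)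
  then show ?thesis by (simp add: LIM_zero_iff)
qed

text \<open>The weight \<open>ln n / n\<close> decreases only once \<open>ln n \<ge> 1\<close>,
  which holds from \<open>n = 3\<close> on; Abel summation starts there and the first two terms are
  estimated separately.\<close>

lemma nonprincipal_log_sum_bounded:
  assumes \<chi>: "\<chi> \<in> dirichlet_chars q" "\<chi> \<noteq> principal_char q" and q: "q > 0"
  shows "\<exists>C. \<forall>N. norm (\<Sum>n=1..N. \<chi> n * of_real (ln (real n)) / of_nat n) \<le> C"
proof -
  define g where "g = (\<lambda>n. ln (real n) / real n)"
  have anti: "g (Suc k) \<le> g k" if k: "k \<ge> 3" for k
  proof -
    have "ln (real (Suc k) / real k) \<le> real (Suc k) / real k - 1"
      using k by (intro ln_le_minus_one) auto
    then have "real k * (ln (real (Suc k)) - ln (real k)) \<le> 1"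
      using k by (simp add: ln_div field_simps)
    also have "1 \<le> ln (real k)"
      using exp_le k by (subst ln_ge_iff) auto
    finally show ?thesis using k by (simp add: g_def field_simps)
  qed
  have nonneg: "g k \<ge> 0" for k by (cases "k = 0") (auto simp: g_def)
  define f where "f = (\<lambda>n. of_real (g n) * \<chi> n)"
  have "norm (\<Sum>n=1..N. f n) \<le> norm (f 1) + norm (f 2) + 2 * real q * g 3" for N
  proof (cases "N < 3")
    case True
    then have "N = 0 \<or> N = 1 \<or> N = 2" by auto
    moreover have "2 * real q * g 3 \<ge> 0" using nonneg[of 3] by simp
    moreover have "(\<Sum>n=1..2. f n) = f 1 + f 2" by (simp add: numeral_2_eq_2)
    ultimately show ?thesis
      using norm_triangle_ineq[of "f 1" "f 2"] by (elim disjE) (simp_all add: add.assoc add_increasing2)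
  next
    case False
    then have "{1..N} = {1, 2} \<union> {3..<Suc N}" by auto
    then have "(\<Sum>n=1..N. f n) = f 1 + f 2 + (\<Sum>n=3..<Suc N. f n)"
      by (simp add: sum.union_disjoint)
    then have "norm (\<Sum>n=1..N. f n) = norm (f 1 + f 2 + (\<Sum>n=3..<Suc N. f n))"
      by (simp only:)
    moreover have "norm (\<Sum>n=3..<Suc N. f n) \<le> 2 * real q * g 3"
      unfolding f_def using False norm_sum_dirichlet_char_le[OF \<chi> q] anti nonneg
      by (intro norm_sum_antimono_le) auto
    ultimately show ?thesis
      using norm_triangle_ineq[of "f 1" "f 2"] norm_triangle_ineq[of "f 1 + f 2" "\<Sum>n=3..<Suc N. f n"]
      by linarith
  qed
  then show ?thesis by (intro exI[of _ "norm (f 1) + norm (f 2) + 2 * real q * g 3"])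
      (simp add: f_def g_def mult.commute)
qed

lemma norm_dirichlet_char_over_le:
  assumes "\<chi> \<in> dirichlet_chars q" "q > 0"
  shows "norm (\<chi> d / of_nat d) \<le> 1 / real d"
  using norm_dirichlet_char_le[OF assms, of d] by (auto simp: norm_divide divide_right_mono)

text \<open>Complete multiplicativity splits \<open>\<chi> n / n\<close> into the factors for
  \<open>d\<close> and \<open>n / d\<close>, so the inner sum becomes a partial sum of the series
  for \<open>dirichlet_L1 \<chi>\<close>.\<close>

lemma sum_char_divisors_rearrange:
  assumes \<chi>: "\<chi> \<in> dirichlet_chars q"
  shows "(\<Sum>n=1..N. \<chi> n / of_nat n * (\<Sum>d | d dvd n. f d))
       = (\<Sum>d=1..N. \<chi> d / of_nat d * f d * (\<Sum>m=1..N div d. \<chi> m / of_nat m))"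
proof -
  have "(\<Sum>n=1..N. \<chi> n / of_nat n * (\<Sum>d | d dvd n. f d))
      = (\<Sum>n=1..N. \<Sum>d | d dvd n. \<chi> d / of_nat d * f d * (\<chi> (n div d) / of_nat (n div d)))"
    unfolding sum_distrib_left
  proof (intro sum.cong refl)
    fix n d :: nat assume "d \<in> {d. d dvd n}"
    then obtain k where k: "n = d * k" by auto
    show "\<chi> n / of_nat n * f d = \<chi> d / of_nat d * f d * (\<chi> (n div d) / of_nat (n div d))"
      by (cases "d = 0") (simp_all add: k dirichlet_char_mult[OF \<chi>])
  qed
  also have "\<dots> = (\<Sum>d=1..N. \<Sum>m=1..N div d. \<chi> d / of_nat d * f d * (\<chi> m / of_nat m))"
    by (rule sum_divisors_rearrange)
  finally show ?thesis by (simp add: sum_distrib_left)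
qed

text \<open>The partial sum up to \<open>N div d\<close> misses the limit by at most
  \<open>2 * q * d / N\<close>; the factor \<open>d\<close> cancels against
  \<open>\<chi> d / d\<close>, leaving a bound free of \<open>d\<close> apart from the
  weight.\<close>

lemma dirichlet_L1_rate_div:
  assumes \<chi>: "\<chi> \<in> dirichlet_chars q" "\<chi> \<noteq> principal_char q" and q: "q > 0"
    and d: "1 \<le> d" "d \<le> N"
  shows "norm (\<chi> d / of_nat d * of_real c * ((\<Sum>m=1..N div d. \<chi> m / of_nat m) - dirichlet_L1 \<chi>))
       \<le> \<bar>c\<bar> * (2 * real q / real N)"
proof -
  have "norm ((\<Sum>m=1..N div d. \<chi> m / of_nat m) - dirichlet_L1 \<chi>) \<le> 2 * real q / real (Suc (N div d))"
    by (rule dirichlet_L1_rate[OF \<chi> q])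
  also have "\<dots> \<le> 2 * real q / (real N / real d)"
    using real_divide_less_div_add_1[of N d] d by (intro divide_left_mono mult_pos_pos) auto
  finally have *: "norm ((\<Sum>m=1..N div d. \<chi> m / of_nat m) - dirichlet_L1 \<chi>) \<le> 2 * real q * real d / real N"
    by simp
  have "norm (\<chi> d / of_nat d * of_real c * ((\<Sum>m=1..N div d. \<chi> m / of_nat m) - dirichlet_L1 \<chi>))
     \<le> 1 / real d * \<bar>c\<bar> * (2 * real q * real d / real N)"
    unfolding norm_mult using *
    by (intro mult_mono norm_dirichlet_char_over_le[OF \<chi>(1) q]) (auto simp: norm_dirichlet_char_over_le[OF \<chi>(1) q])
  then show ?thesis using d by simp
qed

text \<open>Replacing each inner partial sum by its limit turns the bounded logarithmic sum into
  \<open>F * dirichlet_L1 \<chi>\<close> plus an error, and division by the nonzero limit bounds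
  \<open>F\<close>.\<close>

lemma sum_char_mangoldt_bounded:
  assumes \<chi>: "\<chi> \<in> dirichlet_chars q" "\<chi> \<noteq> principal_char q" and q: "q > 0" and L: "dirichlet_L1 \<chi> \<noteq> 0"
  shows "\<exists>C. \<forall>N. norm (\<Sum>n=1..N. \<chi> n / of_nat n * mangoldt n) \<le> C"
proof -
  obtain C where C: "\<And>N. norm (\<Sum>n=1..N. \<chi> n * of_real (ln (real n)) / of_nat n) \<le> C"
    using nonprincipal_log_sum_bounded[OF \<chi> q] by blast
  have "norm (\<Sum>n=1..N. \<chi> n / of_nat n * mangoldt n) \<le> (C + 12 * real q) / norm (dirichlet_L1 \<chi>)" for N
  proof (cases "N = 0")
    case True
    have "C \<ge> 0" using C[of 0] by simp
    then show ?thesis using True by simp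
  next
    case N: False
    define F where "F = (\<Sum>n=1..N. \<chi> n / of_nat n * mangoldt n)"
    have "(\<Sum>n=1..N. \<chi> n * of_real (ln (real n)) / of_nat n)
        = (\<Sum>n=1..N. \<chi> n / of_nat n * (\<Sum>d | d dvd n. mangoldt d))"
      by (intro sum.cong refl) (simp add: mangoldt_sum)
    also have "\<dots> = (\<Sum>d=1..N. \<chi> d / of_nat d * mangoldt d * (\<Sum>m=1..N div d. \<chi> m / of_nat m))"
      by (rule sum_char_divisors_rearrange[OF \<chi>(1)])
    also have "\<dots> = F * dirichlet_L1 \<chi> + (\<Sum>d=1..N. \<chi> d / of_nat d * of_real (mangoldt d) *
        ((\<Sum>m=1..N div d. \<chi> m / of_nat m) - dirichlet_L1 \<chi>))"
      unfolding F_def sum_distrib_right sum.distrib[symmetric] by (intro sum.cong refl) (simp add: algebra_simps)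
    finally have eq: "F * dirichlet_L1 \<chi> = (\<Sum>n=1..N. \<chi> n * of_real (ln (real n)) / of_nat n) -
        (\<Sum>d=1..N. \<chi> d / of_nat d * of_real (mangoldt d) * ((\<Sum>m=1..N div d. \<chi> m / of_nat m) - dirichlet_L1 \<chi>))"
      by (simp add: algebra_simps)
    \<comment> \<open>The weights \<open>mangoldt d\<close> add up to
      \<open>chebyshev_psi N \<le> 6 * N\<close>, so the error stays below
      \<open>12 * q\<close>.\<close>
    have "norm (\<Sum>d=1..N. \<chi> d / of_nat d * of_real (mangoldt d) * ((\<Sum>m=1..N div d. \<chi> m / of_nat m) - dirichlet_L1 \<chi>))
       \<le> (\<Sum>d=1..N. \<bar>mangoldt d\<bar> * (2 * real q / real N))"
      by (intro sum_norm_le dirichlet_L1_rate_div[OF \<chi> q]) auto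
    also have "\<dots> = chebyshev_psi N * (2 * real q / real N)" by (simp only: chebyshev_psi_def abs_mangoldt sum_distrib_right)
    also have "\<dots> \<le> 6 * real N * (2 * real q / real N)" by (intro mult_right_mono chebyshev_psi_le_6) auto
    also have "\<dots> = 12 * real q" using N by simp
    finally have "norm (F * dirichlet_L1 \<chi>) \<le> C + 12 * real q"
      unfolding eq using C[of N] by (intro norm_triangle_le_diff) auto
    then show ?thesis using L by (simp add: F_def norm_mult field_simps)
  qed
  then show ?thesis by blast
qed

text \<open>When the limit is 0 no main term remains, and the rearranged sum consists of error terms
  only. Since \<open>moebius\<close> is bounded by 1, they add up to a multiple of
  \<open>N * ln N - ln (fact N)\<close>, which is at most \<open>N\<close>.\<close>

lemma sum_char_mangoldt_zero:
  assumes \<chi>: "\<chi> \<in> dirichlet_chars q" "\<chi> \<noteq> principal_char q" and q: "q > 0" and L: "dirichlet_L1 \<chi> = 0"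
    and N: "N > 0"
  shows "norm ((\<Sum>n=1..N. \<chi> n / of_nat n * mangoldt n) + of_real (ln (real N))) \<le> 2 * real q"
proof -
  \<comment> \<open>The divisor sum of \<open>h\<close> is \<open>mangoldt n\<close>, with an extra
    \<open>ln N\<close> exactly at \<open>n = 1\<close>; this is the origin of the logarithm in the
    claim.\<close>
  define h where "h = (\<lambda>d. moebius d * ln (real N / real d))"
  have h: "(\<Sum>d | d dvd n. h d) = mangoldt n + (if n = 1 then ln (real N) else 0)"
    if n: "n \<in> {1..N}" for n
  proof -
    have "(\<Sum>d | d dvd n. h d)
        = (\<Sum>d | d dvd n. moebius d * ln (real n / real d) + moebius d * ln (real N / real n))"
    proof (intro sum.cong refl)
      fix d assume "d \<in> {d. d dvd n}"
      then have "d > 0" using n by (auto intro!: Nat.gr0I)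
      then show "h d = moebius d * ln (real n / real d) + moebius d * ln (real N / real n)"
        using n by (simp add: h_def ln_div algebra_simps)
    qed
    also have "\<dots> = mangoldt n + (\<Sum>d | d dvd n. moebius d) * ln (real N / real n)"
      using n by (simp add: sum.distrib sum_moebius_ln sum_distrib_right)
    finally show ?thesis using n by (simp add: sum_moebius_divisors)
  qed
  have "(\<Sum>n=1..N. \<chi> n / of_nat n * mangoldt n) + of_real (ln (real N))
      = (\<Sum>n=1..N. \<chi> n / of_nat n * mangoldt n) + (\<Sum>n=1..N. if n = 1 then of_real (ln (real N)) else 0)"
    using N by simp
  also have "\<dots> = (\<Sum>n=1..N. \<chi> n / of_nat n * of_real (\<Sum>d | d dvd n. h d))"
    unfolding sum.distrib[symmetric] using dirichlet_char_1[OF \<chi>(1)]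
    by (intro sum.cong refl) (simp add: h algebra_simps)
  also have "\<dots> = (\<Sum>n=1..N. \<chi> n / of_nat n * (\<Sum>d | d dvd n. of_real (h d)))" by simp
  also have "\<dots> = (\<Sum>d=1..N. \<chi> d / of_nat d * of_real (h d) * ((\<Sum>m=1..N div d. \<chi> m / of_nat m) - dirichlet_L1 \<chi>))"
    by (simp only: L diff_zero sum_char_divisors_rearrange[OF \<chi>(1)])
  also have "norm \<dots> \<le> (\<Sum>d=1..N. \<bar>h d\<bar> * (2 * real q / real N))"
    by (intro sum_norm_le dirichlet_L1_rate_div[OF \<chi> q]) auto
  also have "\<dots> \<le> (\<Sum>d=1..N. (ln (real N) - ln (real d)) * (2 * real q / real N))"
  proof (intro sum_mono mult_right_mono)
    fix d assume d: "d \<in> {1..N}"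
    have "\<bar>h d\<bar> \<le> 1 * \<bar>ln (real N / real d)\<bar>"
      unfolding h_def abs_mult by (intro mult_right_mono abs_moebius_le) auto
    also have "\<dots> = ln (real N) - ln (real d)" using d by (simp add: ln_div)
    finally show "\<bar>h d\<bar> \<le> ln (real N) - ln (real d)" .
  qed auto
  also have "\<dots> = (real N * ln (real N) - (\<Sum>d=1..N. ln (real d))) * (2 * real q / real N)"
    by (simp only: sum_distrib_right[symmetric] sum_subtractf) simp
  also have "(\<Sum>d=1..N. ln (real d)) = ln (fact N)"
    unfolding fact_prod of_nat_prod by (intro ln_prod[symmetric]) auto
  also have "(real N * ln (real N) - ln (fact N)) * (2 * real q / real N) \<le> real N * (2 * real q / real N)"
    using ln_fact_ge[of N] by (intro mult_right_mono) auto
  also have "\<dots> = 2 * real q" using N by simp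
  finally show ?thesis .
qed

section \<open>Non-vanishing of $L(1,\chi)$\<close>

text \<open>The sequence \<open>u\<close> decreases, \<open>v\<close> increases and lies below it,
  and \<open>A\<close> is the supremum of \<open>v\<close>. For \<open>x\<close> between
  \<open>K\<close> and \<open>K + 1\<close>, both \<open>A\<close> and the expression without
  \<open>A\<close> lie between \<open>v K\<close> and \<open>u K\<close>, whose distance is at most
  \<open>2 / sqrt x\<close>. Real \<open>x\<close> is allowed so that \<open>x = M^2 / d\<close> can
  be inserted below.\<close>

lemma sum_inverse_sqrt_approx:
  "\<exists>A. \<forall>K x. real K \<le> x \<and> x \<le> real (Suc K) \<and> x > 0 \<longrightarrow>
     \<bar>(\<Sum>m=1..K. 1 / sqrt (real m)) - 2 * sqrt x - A\<bar> \<le> 2 / sqrt x"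
proof -
  define H where "H = (\<lambda>K. \<Sum>m=1..K. 1 / sqrt (real m))"
  define u where "u = (\<lambda>K. H K - 2 * sqrt (real K))"
  define v where "v = (\<lambda>K. H K - 2 * sqrt (real (Suc K)))"
  have step: "2 * (sqrt (x + 1) - sqrt x) \<le> 1 / sqrt x" if "x > 0" for x
  proof -
    have "(sqrt (x + 1) - sqrt x) * (sqrt (x + 1) + sqrt x) = 1"
      using that by (simp add: algebra_simps)
    then have "2 * (sqrt (x + 1) - sqrt x) * sqrt x \<le> 1"
      using that mult_left_mono[of "2 * sqrt x" "sqrt (x + 1) + sqrt x" "sqrt (x + 1) - sqrt x"]
      by (simp add: algebra_simps)
    then show ?thesis using that by (simp add: field_simps)
  qed
  have step': "1 / sqrt (x + 1) \<le> 2 * (sqrt (x + 1) - sqrt x)" if "x \<ge> 0" for x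
  proof -
    have "(sqrt (x + 1) - sqrt x) * (sqrt (x + 1) + sqrt x) = 1"
      using that by (simp add: algebra_simps)
    then have "1 \<le> 2 * (sqrt (x + 1) - sqrt x) * sqrt (x + 1)"
      using that mult_left_mono[of "sqrt (x + 1) + sqrt x" "2 * sqrt (x + 1)" "sqrt (x + 1) - sqrt x"]
      by (simp add: algebra_simps)
    then show ?thesis using that by (simp add: field_simps)
  qed
  have "decseq u"
  proof (rule decseq_SucI)
    fix K show "u (Suc K) \<le> u K"
      using step'[of "real K"] by (simp add: u_def H_def algebra_simps)
  qed
  have "incseq v"
  proof (rule incseq_SucI)
    fix K show "v K \<le> v (Suc K)"
      using step[of "real K + 1"] by (simp add: v_def H_def algebra_simps)
  qed
  have "v K \<le> u K" for K by (simp add: u_def v_def)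
  then have vu: "v K \<le> u K'" for K K'
    using incseqD[OF \<open>incseq v\<close>, of K "max K K'"] decseqD[OF \<open>decseq u\<close>, of K' "max K K'"]
    by (meson max.cobounded1 max.cobounded2 order.trans)
  define A where "A = (SUP K. v K)"
  have "bdd_above (range v)" using vu by (auto intro!: bdd_aboveI2)
  then have vA: "v K \<le> A" for K unfolding A_def by (intro cSUP_upper) auto
  have Au: "A \<le> u K" for K unfolding A_def using vu by (intro cSUP_least) auto
  have "\<bar>H K - 2 * sqrt x - A\<bar> \<le> 2 / sqrt x" if x: "real K \<le> x" "x \<le> real (Suc K)" "x > 0" for K x
  proof -
    have s: "sqrt (real K) \<le> sqrt x" "sqrt x \<le> sqrt (real (Suc K))" using x by auto
    have "sqrt (real (Suc K)) - sqrt (real K) \<le> 1 / sqrt (real (Suc K))"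
    proof -
      have "(sqrt (real (Suc K)) - sqrt (real K)) * (sqrt (real (Suc K)) + sqrt (real K)) = 1"
        by (simp add: algebra_simps)
      then have "(sqrt (real (Suc K)) - sqrt (real K)) * sqrt (real (Suc K)) \<le> 1"
        using mult_left_mono[of "sqrt (real (Suc K))" "sqrt (real (Suc K)) + sqrt (real K)"
            "sqrt (real (Suc K)) - sqrt (real K)"] by simp
      then show ?thesis by (simp add: pos_le_divide_eq)
    qed
    also have "\<dots> \<le> 1 / sqrt x" using s x by (intro divide_left_mono) auto
    finally have "2 * sqrt (real (Suc K)) - 2 * sqrt (real K) \<le> 2 / sqrt x" by simp
    then show ?thesis using s vA[of K] Au[of K] unfolding u_def v_def by linarith
  qed
  then show ?thesis unfolding H_def by blast
qed

lemma sum_inverse_sqrt_le: "(\<Sum>m=1..K. 1 / sqrt (real m)) \<le> 2 * sqrt (real K)"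
proof (induction K)
  case (Suc K)
  have "(sqrt (real K) - sqrt (real (Suc K)))\<^sup>2 \<ge> 0" by simp
  then have "1 + 2 * sqrt (real K) * sqrt (real (Suc K)) \<le> 2 * sqrt (real (Suc K)) * sqrt (real (Suc K))"
    by (simp add: power2_eq_square algebra_simps)
  then have "1 / sqrt (real (Suc K)) + 2 * sqrt (real K) \<le> 2 * sqrt (real (Suc K))"
    by (simp add: field_simps)
  then show ?case using Suc by simp
qed auto

text \<open>Dirichlet's hyperbola method: the lattice points with $dm \leq M^2$ are split at $d = M$.\<close>
lemma sum_char_divisors_sqrt_bounded:
  assumes \<chi>: "\<chi> \<in> dirichlet_chars q" "\<chi> \<noteq> principal_char q" and q: "q > 0" and L: "dirichlet_L1 \<chi> = 0"
  shows "\<exists>C. \<forall>M. norm (\<Sum>n=1..M\<^sup>2. (\<Sum>d | d dvd n. \<chi> d) / of_real (sqrt (real n))) \<le> C"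
proof -
  obtain A where A: "\<And>K x. real K \<le> x \<Longrightarrow> x \<le> real (Suc K) \<Longrightarrow> x > 0 \<Longrightarrow>
     \<bar>(\<Sum>m=1..K. 1 / sqrt (real m)) - 2 * sqrt x - A\<bar> \<le> 2 / sqrt x"
    using sum_inverse_sqrt_approx by blast
  define g where "g = (\<lambda>n. 1 / sqrt (real n))"
  define f where "f = (\<lambda>n. of_real (g n) * \<chi> n)"
  have g_anti: "g (Suc k) \<le> g k" if "k \<ge> 1" for k
    unfolding g_def using that by (intro divide_left_mono) auto
  have f_bound: "norm (\<Sum>n=m..<N. f n) \<le> 2 * real q * g m" if "1 \<le> m" "m \<le> N" for m N
    unfolding f_def using that norm_sum_dirichlet_char_le[OF \<chi> q] g_anti
    by (intro norm_sum_antimono_le) (auto simp: g_def)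
  have norm_f: "norm (f d) \<le> g d" for d
    using norm_dirichlet_char_le[OF \<chi>(1) q, of d] by (simp add: f_def g_def norm_mult norm_divide divide_right_mono)
  \<comment> \<open>The pairs with \<open>d > M\<close> contribute at most \<open>4 * q\<close>;
    those with \<open>d \<le> M\<close> contribute \<open>4 * q\<close> from the main term,
    \<open>2 * q * \<bar>A\<bar>\<close> from the constant and 2 from the error.\<close>
  have "norm (\<Sum>n=1..M\<^sup>2. (\<Sum>d | d dvd n. \<chi> d) / of_real (sqrt (real n))) \<le> 8 * real q + 2 * real q * \<bar>A\<bar> + 2"
    for M
  proof (cases "M = 0")
    case M: False
    have un: "{1..M\<^sup>2} = {1..M} \<union> {Suc M..M\<^sup>2}"
      using self_le_power[of M 2] M by auto
    have "(\<Sum>n=1..M\<^sup>2. (\<Sum>d | d dvd n. \<chi> d) / of_real (sqrt (real n)))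
        = (\<Sum>n=1..M\<^sup>2. \<Sum>d | d dvd n. f d * of_real (g (n div d)))"
      unfolding sum_divide_distrib
    proof (intro sum.cong refl)
      fix n d :: nat assume "d \<in> {d. d dvd n}"
      then obtain k where k: "n = d * k" by auto
      show "\<chi> d / of_real (sqrt (real n)) = f d * of_real (g (n div d))"
        by (cases "d = 0") (simp_all add: k f_def g_def real_sqrt_mult)
    qed
    also have "\<dots> = (\<Sum>d=1..M\<^sup>2. \<Sum>m=1..M\<^sup>2 div d. f d * of_real (g m))"
      by (rule sum_divisors_rearrange)
    also have "\<dots> = (\<Sum>d=1..M. f d * of_real (\<Sum>m=1..M\<^sup>2 div d. g m)) +
         (\<Sum>d=Suc M..M\<^sup>2. \<Sum>m=1..M\<^sup>2 div d. f d * of_real (g m))"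
      by (subst un, subst sum.union_disjoint) (auto simp: sum_distrib_left)
    finally have split: "(\<Sum>n=1..M\<^sup>2. (\<Sum>d | d dvd n. \<chi> d) / of_real (sqrt (real n))) =
         (\<Sum>d=1..M. f d * of_real (\<Sum>m=1..M\<^sup>2 div d. g m)) +
         (\<Sum>d=Suc M..M\<^sup>2. \<Sum>m=1..M\<^sup>2 div d. f d * of_real (g m))" .
    have "(\<Sum>d=Suc M..M\<^sup>2. \<Sum>m=1..M\<^sup>2 div d. f d * of_real (g m))
        = (\<Sum>(d, m)\<in>(SIGMA d:{Suc M..M\<^sup>2}. {1..M\<^sup>2 div d}). f d * of_real (g m))"
      by (rule sum.Sigma) auto
    \<comment> \<open>Here \<open>d > M\<close> forces \<open>m \<le> M\<close>. Summing over
      \<open>d\<close> first leaves character sums over intervals starting beyond \<open>M\<close>,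
      which are small by \<open>f_bound\<close>.\<close>
    also have "\<dots> = (\<Sum>(m, d)\<in>(SIGMA m:{1..M}. {Suc M..<Suc (M\<^sup>2 div m)}). f d * of_real (g m))"
    proof (rule sum.reindex_bij_witness[where i = "\<lambda>(m, d). (d, m)" and j = "\<lambda>(d, m). (m, d)"])
      fix a assume "a \<in> (SIGMA d:{Suc M..M\<^sup>2}. {1..M\<^sup>2 div d})"
      then obtain d m where a: "a = (d, m)" "Suc M \<le> d" "1 \<le> m" "d * m \<le> M\<^sup>2"
        by (auto simp: less_eq_div_iff_mult_less_eq mult.commute)
      have "m \<le> M"
      proof (rule ccontr)
        assume "\<not> m \<le> M"
        then have "Suc M * Suc M \<le> d * m" using a by (intro mult_le_mono) auto
        with a show False by (simp add: power2_eq_square)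
      qed
      then show "(case a of (d, m) \<Rightarrow> (m, d)) \<in> (SIGMA m:{1..M}. {Suc M..<Suc (M\<^sup>2 div m)})"
        using a by (auto simp: less_Suc_eq_le less_eq_div_iff_mult_less_eq)
    next
      fix a assume "a \<in> (SIGMA m:{1..M}. {Suc M..<Suc (M\<^sup>2 div m)})"
      then obtain d m where a: "a = (m, d)" "Suc M \<le> d" "1 \<le> m" "d * m \<le> M\<^sup>2"
        by (auto simp: less_Suc_eq_le less_eq_div_iff_mult_less_eq)
      have "d \<le> d * m" using a(3) by simp
      then have "d \<le> M\<^sup>2" using a(4) by (rule order.trans)
      then show "(case a of (m, d) \<Rightarrow> (d, m)) \<in> (SIGMA d:{Suc M..M\<^sup>2}. {1..M\<^sup>2 div d})"
        using a by (auto simp: less_eq_div_iff_mult_less_eq mult.commute)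
    qed auto
    also have "\<dots> = (\<Sum>m=1..M. \<Sum>d=Suc M..<Suc (M\<^sup>2 div m). f d * of_real (g m))"
      by (rule sum.Sigma[symmetric]) auto
    also have "\<dots> = (\<Sum>m=1..M. (\<Sum>d=Suc M..<Suc (M\<^sup>2 div m). f d) * of_real (g m))"
      by (simp only: sum_distrib_right)
    also have "norm \<dots> \<le> (\<Sum>m=1..M. (2 * real q * g (Suc M)) * g m)"
    proof (intro sum_norm_le)
      fix m assume m: "m \<in> {1..M}"
      have "M * m \<le> M\<^sup>2" using m by (simp add: power2_eq_square)
      then have "Suc M \<le> Suc (M\<^sup>2 div m)" using m by (simp add: less_eq_div_iff_mult_less_eq)
      then have "norm (\<Sum>d=Suc M..<Suc (M\<^sup>2 div m). f d) \<le> 2 * real q * g (Suc M)"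
        by (intro f_bound) auto
      then show "norm ((\<Sum>d=Suc M..<Suc (M\<^sup>2 div m). f d) * of_real (g m)) \<le> 2 * real q * g (Suc M) * g m"
        unfolding norm_mult by (intro mult_mono) (auto simp: g_def norm_divide)
    qed
    also have "\<dots> = 2 * real q * (g (Suc M) * (\<Sum>m=1..M. g m))"
      by (simp add: sum_distrib_left mult_ac)
    also have "\<dots> \<le> 2 * real q * (g (Suc M) * (2 * sqrt (real (Suc M))))"
    proof (intro mult_left_mono)
      have "(\<Sum>m=1..M. g m) \<le> 2 * sqrt (real M)" unfolding g_def by (rule sum_inverse_sqrt_le)
      also have "\<dots> \<le> 2 * sqrt (real (Suc M))" by simp
      finally show "(\<Sum>m=1..M. g m) \<le> 2 * sqrt (real (Suc M))" .
    qed (auto simp: g_def)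
    also have "\<dots> = 4 * real q" by (simp add: g_def)
    finally have second: "norm (\<Sum>d=Suc M..M\<^sup>2. \<Sum>m=1..M\<^sup>2 div d. f d * of_real (g m)) \<le> 4 * real q" .
    \<comment> \<open>The error of the square-root approximation at \<open>x = M^2 / d\<close>,
      where \<open>2 * sqrt x = 2 * M / sqrt d\<close>.\<close>
    define e where "e = (\<lambda>d. (\<Sum>m=1..M\<^sup>2 div d. g m) - 2 * real M / sqrt (real d) - A)"
    have e: "\<bar>e d\<bar> \<le> 2 * sqrt (real d) / real M" if d: "d \<in> {1..M}" for d
    proof -
      define x where "x = (real M)\<^sup>2 / real d"
      have "\<bar>(\<Sum>m=1..M\<^sup>2 div d. 1 / sqrt (real m)) - 2 * sqrt x - A\<bar> \<le> 2 / sqrt x"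
        using real_divide_less_div_add_1[of "M\<^sup>2" d] of_nat_div_le_of_nat[of "M\<^sup>2" d, where ?'a = real] d M
        by (intro A) (auto simp: x_def)
      moreover have "sqrt x = real M / sqrt (real d)" by (simp add: x_def real_sqrt_divide)
      ultimately show ?thesis by (simp add: e_def g_def)
    qed
    have "(\<Sum>d=1..M. f d * of_real (\<Sum>m=1..M\<^sup>2 div d. g m)) =
       (\<Sum>d=1..M. of_real (2 * real M) * (\<chi> d / of_nat d) + of_real A * f d + f d * of_real (e d))"
    proof (intro sum.cong refl)
      fix d assume "d \<in> {1..M}"
      then have eq: "f d * of_real (1 / sqrt (real d)) = \<chi> d / of_nat d"
        by (simp add: f_def g_def flip: of_real_mult)
      have sum_g: "(\<Sum>m=1..M\<^sup>2 div d. g m) = 2 * real M * (1 / sqrt (real d)) + A + e d"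
        by (simp add: e_def)
      show "f d * of_real (\<Sum>m=1..M\<^sup>2 div d. g m) =
          of_real (2 * real M) * (\<chi> d / of_nat d) + of_real A * f d + f d * of_real (e d)"
        by (simp only: sum_g of_real_add of_real_mult ring_distribs eq[symmetric] mult_ac)
    qed
    also have "\<dots> = of_real (2 * real M) * (\<Sum>d=1..M. \<chi> d / of_nat d) + of_real A * (\<Sum>d=1..M. f d)
        + (\<Sum>d=1..M. f d * of_real (e d))"
      by (simp only: sum.distrib sum_distrib_left)
    also have "norm \<dots> \<le> 4 * real q + \<bar>A\<bar> * (2 * real q) + 2"
    proof (intro norm_triangle_mono)
      \<comment> \<open>As the limit is 0, the partial sum is itself \<open>O(1 / M)\<close>, which
        compensates the factor \<open>2 * M\<close> of the main term.\<close>
      have "norm (\<Sum>d=1..M. \<chi> d / of_nat d) \<le> 2 * real q / real (Suc M)"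
        using dirichlet_L1_rate[OF \<chi> q, of M] L by simp
      also have "\<dots> \<le> 2 * real q / real M" using M by (intro divide_left_mono) auto
      finally have "2 * real M * norm (\<Sum>d=1..M. \<chi> d / of_nat d) \<le> 2 * real M * (2 * real q / real M)"
        by (intro mult_left_mono) auto
      then show "norm (of_real (2 * real M) * (\<Sum>d=1..M. \<chi> d / of_nat d)) \<le> 4 * real q"
        using M by (simp add: norm_mult)
      have "norm (\<Sum>d=1..M. f d) \<le> 2 * real q"
        using f_bound[of 1 "Suc M"] by (simp add: g_def atLeastLessThanSuc_atLeastAtMost)
      then show "norm (of_real A * (\<Sum>d=1..M. f d)) \<le> \<bar>A\<bar> * (2 * real q)"
        unfolding norm_mult by (intro mult_mono) auto
      have "norm (\<Sum>d=1..M. f d * of_real (e d)) \<le> (\<Sum>d=1..M. g d * (2 * sqrt (real d) / real M))"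
        by (rule sum_norm_le, unfold norm_mult norm_of_real, intro mult_mono norm_f e) (auto simp: g_def)
      also have "\<dots> = (\<Sum>d=1..M. 2 / real M)"
        by (intro sum.cong) (auto simp: g_def)
      finally show "norm (\<Sum>d=1..M. f d * of_real (e d)) \<le> 2" using M by simp
    qed
    finally show ?thesis unfolding split using second
      by (intro norm_triangle_le) (simp add: algebra_simps)
  qed auto
  then show ?thesis by blast
qed

section \<open>Divisor sums of real characters and the real case of non-vanishing\<close>

definition quasi_real_char :: "(nat \<Rightarrow> real) \<Rightarrow> bool" where
  "quasi_real_char r \<longleftrightarrow> r 1 = 1 \<and> (\<forall>m n. r (m * n) = r m * r n) \<and> (\<forall>n. r n \<in> {-1, 0, 1})"

text \<open>The divisors of \<open>p ^ k * m\<close> are the products of some \<open>p ^ i\<close>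
  and some divisor of \<open>m\<close>, each obtained once because \<open>p\<close> does not divide
  \<open>m\<close>.\<close>

lemma sum_divisors_prime_power_mult:
  fixes r :: "nat \<Rightarrow> real"
  assumes mult: "\<And>m n. r (m * n) = r m * r n" and p: "prime p" "\<not> p dvd m"
  shows "(\<Sum>d | d dvd p ^ k * m. r d) = (\<Sum>i\<le>k. r (p ^ i)) * (\<Sum>d | d dvd m. r d)"
proof -
  have p0: "p > 0" using p by (simp add: prime_gt_0_nat)
  have "(\<Sum>i\<le>k. r (p ^ i)) * (\<Sum>d | d dvd m. r d) = (\<Sum>(i, d)\<in>{..k} \<times> {d. d dvd m}. r (p ^ i * d))"
    by (simp add: sum_product sum.cartesian_product mult)
  also have "\<dots> = (\<Sum>d\<in>(\<lambda>(i, d). p ^ i * d) ` ({..k} \<times> {d. d dvd m}). r d)"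
  proof (subst sum.reindex)
    show "inj_on (\<lambda>(i, d). p ^ i * d) ({..k} \<times> {d. d dvd m})"
    proof (rule inj_onI, clarify)
      fix i d j e assume *: "p ^ i * d = p ^ j * e" "d dvd m" "e dvd m"
      then have "\<not> p dvd d" "\<not> p dvd e" using p by (meson dvd_trans)+
      \<comment> \<open>Both exponents are the multiplicity of \<open>p\<close> in the common
        product.\<close>
      then have "i = j" using *(1) p
        by (metis multiplicity_prime_elem_times_other multiplicity_prime_power not_dvd_imp_multiplicity_0
            prime_imp_prime_elem multiplicity_decomposeI mult.commute)
      with * p0 show "i = j \<and> d = e" by auto
    qed
  qed (auto simp: case_prod_unfold)
  also have "(\<lambda>(i, d). p ^ i * d) ` ({..k} \<times> {d. d dvd m}) = {d. d dvd p ^ k * m}"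
  proof (intro equalityI subsetI)
    fix d assume "d \<in> {d. d dvd p ^ k * m}"
    then obtain a b where ab: "d = a * b" "a dvd p ^ k" "b dvd m" by (auto elim: dvd_productE)
    then obtain i where "i \<le> k" "a = p ^ i" using p(1) by (auto simp: divides_primepow_nat)
    with ab show "d \<in> (\<lambda>(i, d). p ^ i * d) ` ({..k} \<times> {d. d dvd m})" by force
  qed (auto intro!: mult_dvd_mono le_imp_power_dvd)
  finally show ?thesis ..
qed

text \<open>Prime powers split off one at a time. The factor \<open>1 + r p + ... + r p ^ k\<close>
  is \<open>k + 1\<close> or 1 if \<open>r p\<close> is 1 or 0, and alternates between 1 and 0 if
  \<open>r p = -1\<close>: it is nonnegative, and at least 1 for even \<open>k\<close>. In a square
  all exponents are even. The \<open>of_bool\<close> states both bounds in a form suited to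
  induction.\<close>

lemma quasi_real_char_sum_divisors:
  assumes r: "quasi_real_char r" and n: "n > 0"
  shows "(\<Sum>d | d dvd n. r d) \<ge> of_bool (\<exists>s. n = s\<^sup>2)"
  using n
proof (induction n rule: less_induct)
  case (less n)
  show ?case
  proof (cases "n = 1")
    case True
    then show ?thesis using r by (auto simp: quasi_real_char_def)
  next
    case False
    then obtain p where p: "prime p" "p dvd n" using prime_factor_nat by blast
    obtain m where m: "n = p ^ multiplicity p n * m" "\<not> p dvd m"
      using multiplicity_decompose'[of n p] p less.prems by (auto simp: prime_nat_iff)
    define k where "k = multiplicity p n"
    have k: "k > 0" using p less.prems by (simp add: k_def prime_multiplicity_gt_zero_iff)
    have nk: "n = p ^ k * m" using m by (simp add: k_def)
    have m0: "m > 0" using less.prems nk by (auto intro!: Nat.gr0I)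
    have "1 < p ^ k" using one_less_power[OF prime_gt_1_nat[OF p(1)] k] .
    then have mn: "m < n" using m0 by (simp add: nk)
    have mult: "r (a * b) = r a * r b" for a b using r by (simp add: quasi_real_char_def)
    have pow: "r (p ^ i) = r p ^ i" for i
      using r by (induction i) (auto simp: quasi_real_char_def)
    have *: "(\<Sum>d | d dvd n. r d) = (\<Sum>i\<le>k. r p ^ i) * (\<Sum>d | d dvd m. r d)"
      using sum_divisors_prime_power_mult[OF mult p(1) m(2)] by (simp add: nk pow)
    have geom: "(\<Sum>i\<le>k. r p ^ i) \<ge> of_bool (even k)"
    proof -
      have alt: "(\<Sum>i\<le>k. (-1::real) ^ i) = of_bool (even k)" by (induction k) auto
      have zero: "(\<Sum>i\<le>k. (0::real) ^ i) = 1" by (induction k) auto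
      have "r p = -1 \<or> r p = 0 \<or> r p = 1" using r by (auto simp: quasi_real_char_def)
      then show ?thesis using alt zero by auto
    qed
    have sq: "even k \<and> (\<exists>s. m = s\<^sup>2)" if "n = s\<^sup>2" for s
    proof -
      have s0: "s \<noteq> 0" using that less.prems by auto
      obtain t where t: "s = p ^ multiplicity p s * t" "\<not> p dvd t"
        using multiplicity_decompose'[of s p] p s0 by (auto simp: prime_nat_iff)
      have k2: "k = 2 * multiplicity p s"
        unfolding k_def that using p s0 by (simp add: prime_elem_multiplicity_power_distrib)
      have "n = p ^ (2 * multiplicity p s) * t\<^sup>2"
        using that t(1) by (metis power_mult power_mult_distrib mult.commute)
      then have "m = t\<^sup>2" using nk p k2 by (auto simp: prime_gt_0_nat)
      with k2 show ?thesis by auto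
    qed
    have IH: "(\<Sum>d | d dvd m. r d) \<ge> of_bool (\<exists>s. m = s\<^sup>2)" by (rule less.IH[OF mn m0])
    have "of_bool (\<exists>s. n = s\<^sup>2) \<le> (of_bool (even k) * of_bool (\<exists>s. m = s\<^sup>2) :: real)"
      using sq by auto
    also have "\<dots> \<le> (\<Sum>i\<le>k. r p ^ i) * (\<Sum>d | d dvd m. r d)"
      using geom IH by (intro mult_mono) (auto intro: order.trans[of _ "of_bool (even k)"])
    finally show ?thesis using * by simp
  qed
qed

lemma ln_le_harmonic: "ln (real (Suc N)) \<le> (\<Sum>n=1..N. 1 / real n)"
proof (induction N)
  case (Suc N)
  have "ln (real (Suc (Suc N)) / real (Suc N)) \<le> real (Suc (Suc N)) / real (Suc N) - 1"
    by (intro ln_le_minus_one) auto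
  also have "\<dots> = 1 / real (Suc N)" by (simp add: field_simps)
  finally have "ln (real (Suc (Suc N))) \<le> ln (real (Suc N)) + 1 / real (Suc N)"
    by (simp add: ln_div)
  then show ?case using Suc by simp
qed auto

text \<open>The contradictions below all come from a bound on \<open>ln N\<close> uniform in
  \<open>N > 0\<close>.\<close>

lemma unbounded_ln: "\<exists>N>0. ln (real N) > C"
proof -
  have "filterlim (\<lambda>N. ln (real N)) at_top sequentially"
    by (rule filterlim_compose[OF ln_at_top filterlim_real_sequentially])
  then have "eventually (\<lambda>N. ln (real N) > C) sequentially" by (simp add: filterlim_at_top_dense)
  then have "eventually (\<lambda>N. N > 0 \<and> ln (real N) > C) sequentially"
    using eventually_gt_at_top[of "0::nat"] by eventually_elim auto
  then show ?thesis by (auto dest: eventually_happens)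
qed

lemma dirichlet_L1_neq_0_real:
  assumes \<chi>: "\<chi> \<in> dirichlet_chars q" "\<chi> \<noteq> principal_char q" and q: "q > 0"
    and real: "\<And>n. cnj (\<chi> n) = \<chi> n"
  shows "dirichlet_L1 \<chi> \<noteq> 0"
proof
  assume L: "dirichlet_L1 \<chi> = 0"
  define r where "r = (\<lambda>n. Re (\<chi> n))"
  have \<chi>r: "\<chi> n = of_real (r n)" for n
    using real[of n] by (simp add: r_def complex_eq_iff)
  have "r n \<in> {-1, 0, 1}" for n
    using norm_dirichlet_char[OF \<chi>(1) _ q, of n] dirichlet_char_eq_0_iff[OF \<chi>(1), of n]
    by (cases "coprime n q") (auto simp: \<chi>r abs_if split: if_splits)
  then have r: "quasi_real_char r"
    using dirichlet_char_1[OF \<chi>(1)] dirichlet_char_mult[OF \<chi>(1)]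
    unfolding quasi_real_char_def \<chi>r by (metis of_real_eq_1_iff of_real_eq_iff of_real_mult)
  obtain C where C: "\<And>M. norm (\<Sum>n=1..M\<^sup>2. (\<Sum>d | d dvd n. \<chi> d) / of_real (sqrt (real n))) \<le> C"
    using sum_char_divisors_sqrt_bounded[OF \<chi> q L] by blast
  have "ln (real M) \<le> C" if "M > 0" for M
  proof -
    have "ln (real M) \<le> ln (real (Suc M))" using that by simp
    also have "\<dots> \<le> (\<Sum>k=1..M. 1 / real k)" by (rule ln_le_harmonic)
    \<comment> \<open>The harmonic sum is placed on the squares \<open>n = k^2\<close>, where
      \<open>1 / sqrt n = 1 / k\<close> and the divisor sum is at least 1.\<close>
    also have "\<dots> = (\<Sum>n\<in>(\<lambda>k. k\<^sup>2) ` {1..M}. 1 / sqrt (real n))"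
      by (subst sum.reindex) (auto simp: inj_on_def)
    also have "\<dots> \<le> (\<Sum>n\<in>(\<lambda>k. k\<^sup>2) ` {1..M}. (\<Sum>d | d dvd n. r d) / sqrt (real n))"
    proof (intro sum_mono divide_right_mono)
      fix n assume "n \<in> (\<lambda>k. k\<^sup>2) ` {1..M}"
      then show "1 \<le> (\<Sum>d | d dvd n. r d)" using quasi_real_char_sum_divisors[OF r, of n] by auto
    qed auto
    also have "\<dots> \<le> (\<Sum>n=1..M\<^sup>2. (\<Sum>d | d dvd n. r d) / sqrt (real n))"
    proof (intro sum_mono2 divide_nonneg_nonneg)
      fix n assume "n \<in> {1..M\<^sup>2} - (\<lambda>k. k\<^sup>2) ` {1..M}"
      then show "0 \<le> (\<Sum>d | d dvd n. r d)"
        using quasi_real_char_sum_divisors[OF r, of n] by (auto intro: order.trans[rotated])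
    qed (auto intro!: power_mono)
    also have "\<dots> \<le> norm (of_real (\<Sum>n=1..M\<^sup>2. (\<Sum>d | d dvd n. r d) / sqrt (real n)) :: complex)"
      unfolding norm_of_real by (rule abs_ge_self)
    also have "\<dots> = norm (\<Sum>n=1..M\<^sup>2. (\<Sum>d | d dvd n. \<chi> d) / of_real (sqrt (real n)))"
      by (simp only: \<chi>r of_real_sum of_real_divide)
    also have "\<dots> \<le> C" by (rule C)
    finally show ?thesis .
  qed
  then show False using unbounded_ln[of C] by (meson not_le)
qed

text \<open>Orthogonality isolates the terms with \<open>n\<close> congruent to \<open>a\<close>.
  The right-hand side is a nonnegative real, which is what the uniqueness of a vanishing value uses
  at \<open>a = 1\<close>.\<close>

lemma sum_chars_mangoldt:
  assumes q: "squarefree q" and a: "coprime a q"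
  shows "(\<Sum>\<chi>\<in>dirichlet_chars q. cnj (\<chi> a) * (\<Sum>n=1..N. \<chi> n / of_nat n * mangoldt n))
    = of_real (real (card (dirichlet_chars q)) * (\<Sum>n | n \<in> {1..N} \<and> [n = a] (mod q). mangoldt n / real n))"
proof -
  have "(\<Sum>\<chi>\<in>dirichlet_chars q. cnj (\<chi> a) * (\<Sum>n=1..N. \<chi> n / of_nat n * mangoldt n))
      = (\<Sum>n=1..N. \<Sum>\<chi>\<in>dirichlet_chars q. cnj (\<chi> a) * (\<chi> n / of_nat n * mangoldt n))"
    by (subst sum.swap) (simp only: sum_distrib_left)
  also have "\<dots> = (\<Sum>n=1..N. (\<Sum>\<chi>\<in>dirichlet_chars q. cnj (\<chi> a) * \<chi> n) * (mangoldt n / of_nat n))"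
    unfolding sum_distrib_right by (intro sum.cong refl) simp
  also have "\<dots> = (\<Sum>n=1..N. if [n = a] (mod q)
      then of_real (real (card (dirichlet_chars q)) * (mangoldt n / real n)) else 0)"
    by (intro sum.cong refl) (simp add: sum_dirichlet_chars[OF assms])
  also have "\<dots> = (\<Sum>n | n \<in> {1..N} \<and> [n = a] (mod q).
      of_real (real (card (dirichlet_chars q)) * (mangoldt n / real n)))"
    by (subst sum.inter_filter[symmetric]) auto
  finally show ?thesis by (simp add: sum_distrib_left)
qed

text \<open>Covers both cases before non-vanishing is known: the sum is either bounded or
  \<open>-ln N\<close> up to a bounded error, hence bounded above.\<close>

lemma nonprincipal_Re_bounded_above:
  assumes \<chi>: "\<chi> \<in> dirichlet_chars q" "\<chi> \<noteq> principal_char q" and q: "q > 0"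
  shows "\<exists>C\<ge>0. \<forall>N>0. Re (\<Sum>n=1..N. \<chi> n / of_nat n * mangoldt n) \<le> C"
proof (cases "dirichlet_L1 \<chi> = 0")
  case True
  have "Re (\<Sum>n=1..N. \<chi> n / of_nat n * mangoldt n) \<le> 2 * real q" if "N > 0" for N
  proof -
    have "Re (\<Sum>n=1..N. \<chi> n / of_nat n * mangoldt n) + ln (real N) \<le> 2 * real q"
      using order.trans[OF complex_Re_le_cmod sum_char_mangoldt_zero[OF \<chi> q True that]] by simp
    moreover have "ln (real N) \<ge> 0" using that by simp
    ultimately show ?thesis by linarith
  qed
  then show ?thesis by (intro exI[of _ "2 * real q"]) auto
next
  case False
  then obtain C where C: "\<And>N. norm (\<Sum>n=1..N. \<chi> n / of_nat n * mangoldt n) \<le> C"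
    using sum_char_mangoldt_bounded[OF \<chi> q] by blast
  moreover have "C \<ge> 0" using order.trans[OF norm_ge_zero C[of 0]] .
  ultimately show ?thesis using complex_Re_le_cmod order.trans by meson
qed

text \<open>Two vanishing values would contribute \<open>-2 * ln N\<close> against
  \<open>ln N\<close> from the principal character, while the others are bounded above; the total
  would become negative.\<close>

lemma dirichlet_L1_zero_unique:
  assumes q: "squarefree q"
    and \<chi>: "\<chi> \<in> dirichlet_chars q" "\<chi> \<noteq> principal_char q" "dirichlet_L1 \<chi> = 0"
    and \<psi>: "\<psi> \<in> dirichlet_chars q" "\<psi> \<noteq> principal_char q" "dirichlet_L1 \<psi> = 0"
  shows "\<chi> = \<psi>"
proof (rule ccontr)
  assume neq: "\<chi> \<noteq> \<psi>"
  have q0: "q > 0" using q by (cases "q = 0") auto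
  define D where "D = dirichlet_chars q - {principal_char q, \<chi>, \<psi>}"
  define F where "F = (\<lambda>\<chi> N. \<Sum>n=1..N. \<chi> n / of_nat n * mangoldt n :: complex)"
  have fin: "finite D" using finite_dirichlet_chars[OF q0] by (simp add: D_def)
  have D: "dirichlet_chars q = insert (principal_char q) (insert \<chi> (insert \<psi> D))"
    using \<chi> \<psi> principal_char_in by (auto simp: D_def)
  have "\<forall>\<theta>\<in>D. \<exists>C\<ge>0. \<forall>N>0. Re (F \<theta> N) \<le> C"
    unfolding F_def using nonprincipal_Re_bounded_above q0 by (auto simp: D_def)
  then obtain C where C: "\<And>\<theta> N. \<theta> \<in> D \<Longrightarrow> N > 0 \<Longrightarrow> Re (F \<theta> N) \<le> C \<theta>" by metis
  have "ln (real N) \<le> 6 + 4 * real q + sum C D" if N: "N > 0" for N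
  proof -
    have zero: "Re (F \<theta> N) + ln (real N) \<le> 2 * real q"
      if "\<theta> \<in> dirichlet_chars q" "\<theta> \<noteq> principal_char q" "dirichlet_L1 \<theta> = 0" for \<theta>
      using order.trans[OF complex_Re_le_cmod sum_char_mangoldt_zero[OF that(1,2) q0 that(3) N]]
      by (simp add: F_def)
    have "norm (F (principal_char q) N) \<le> (\<Sum>n=1..N. mangoldt n / real n)"
      unfolding F_def using norm_dirichlet_char_le[OF principal_char_in q0]
      by (intro sum_norm_le) (auto simp: norm_mult norm_divide principal_char_def mangoldt_nonneg)
    also have "\<dots> \<le> ln (real N) + 6" by (rule sum_mangoldt_over_le[OF N])
    finally have prin: "Re (F (principal_char q) N) \<le> ln (real N) + 6"
      using complex_Re_le_cmod order.trans by blast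
    have "(\<Sum>\<theta>\<in>dirichlet_chars q. cnj (\<theta> 1) * F \<theta> N) = (\<Sum>\<theta>\<in>dirichlet_chars q. F \<theta> N)"
      by (intro sum.cong refl) (simp only: dirichlet_char_1, simp)
    then have "0 \<le> Re (\<Sum>\<theta>\<in>dirichlet_chars q. F \<theta> N)"
      using sum_chars_mangoldt[OF q, of 1 N] unfolding F_def
      by (simp add: sum_nonneg mangoldt_nonneg)
    also have "\<dots> = Re (F (principal_char q) N) + Re (F \<chi> N) + Re (F \<psi> N) + (\<Sum>\<theta>\<in>D. Re (F \<theta> N))"
      unfolding D using fin \<chi> \<psi> neq by (simp add: D_def)
    also have "(\<Sum>\<theta>\<in>D. Re (F \<theta> N)) \<le> sum C D"
      using C N by (intro sum_mono) auto
    finally show ?thesis using zero[OF \<chi>] zero[OF \<psi>] prin by linarith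
  qed
  then show False using unbounded_ln[of "6 + 4 * real q + sum C D"] by (meson not_le)
qed

text \<open>The conjugate character has the conjugate value, so by uniqueness a vanishing value
  forces the character to be real, and the real case applies.\<close>

theorem dirichlet_L1_neq_0:
  assumes q: "squarefree q" and \<chi>: "\<chi> \<in> dirichlet_chars q" "\<chi> \<noteq> principal_char q"
  shows "dirichlet_L1 \<chi> \<noteq> 0"
proof
  assume L: "dirichlet_L1 \<chi> = 0"
  have q0: "q > 0" using q by (cases "q = 0") auto
  define \<psi> where "\<psi> = (\<lambda>n. cnj (\<chi> n))"
  have "(\<lambda>M. cnj (\<Sum>n=1..M. \<chi> n / of_nat n)) \<longlonglongrightarrow> cnj (dirichlet_L1 \<chi>)"
    by (intro tendsto_cnj dirichlet_L1_tendsto[OF \<chi> q0])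
  then have "dirichlet_L1 \<psi> = 0" unfolding dirichlet_L1_def[of \<psi>] by (intro limI) (simp add: \<psi>_def L)
  moreover have "\<psi> \<in> dirichlet_chars q" unfolding \<psi>_def by (rule dirichlet_chars_cnj[OF \<chi>(1)])
  moreover have "\<psi> \<noteq> principal_char q"
  proof
    assume "\<psi> = principal_char q"
    then have "cnj (\<chi> n) = principal_char q n" for n by (metis \<psi>_def)
    then have "\<chi> n = principal_char q n" for n
      by (metis complex_cnj_cnj complex_cnj_one complex_cnj_zero of_bool_def principal_char_def)
    with \<chi>(2) show False by auto
  qed
  ultimately have "\<psi> = \<chi>" using dirichlet_L1_zero_unique[OF q] \<chi> L by blast
  then have "cnj (\<chi> n) = \<chi> n" for n by (metis \<psi>_def)
  then show False using dirichlet_L1_neq_0_real[OF \<chi> q0] L by blast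
qed

section \<open>Primes in arithmetic progressions with squarefree modulus\<close>

text \<open>Telescoping: the term at \<open>n\<close> is at most
  \<open>2 / sqrt (n - 1) - 2 / sqrt n\<close>.\<close>

lemma sum_inverse_n_sqrt_n_le:
  "(\<Sum>n=2..Suc N. 1 / (real n * sqrt (real n))) \<le> 2 - 2 / sqrt (real (Suc N))"
proof (induction N)
  case (Suc N)
  define a b where "a = sqrt (real (Suc N))" and "b = sqrt (real (Suc (Suc N)))"
  have ab: "a > 0" "b > 0" "a \<le> b" by (auto simp: a_def b_def)
  have b2: "real (Suc (Suc N)) = b\<^sup>2" by (simp add: b_def)
  have "(b - a) * (b + a) = 1" by (simp add: a_def b_def algebra_simps)
  then have "1 \<le> (b - a) * (2 * b)" using mult_left_mono[of "b + a" "2 * b" "b - a"] ab by simp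
  then have "1 * b \<le> (b - a) * (2 * b) * b" using ab by (intro mult_right_mono) auto
  then have "a \<le> (b - a) * (2 * b) * b" using ab by linarith
  then have "1 / (b\<^sup>2 * b) + 2 / b \<le> 2 / a" using ab by (simp add: field_simps power2_eq_square)
  moreover have "(\<Sum>n=2..Suc (Suc N). 1 / (real n * sqrt (real n)))
      = (\<Sum>n=2..Suc N. 1 / (real n * sqrt (real n))) + 1 / (b\<^sup>2 * b)"
    by (subst sum.cl_ivl_Suc) (simp add: b2[symmetric] b_def)
  ultimately show ?case using Suc.IH unfolding a_def b_def by linarith
qed auto

text \<open>Only powers \<open>p ^ k\<close> with \<open>k \<ge> 2\<close> contribute. The geometric
  sum is at most \<open>2 / p^2\<close> and \<open>ln p \<le> 2 * sqrt p\<close>, so each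
  \<open>p\<close> costs at most \<open>4 / (p * sqrt p)\<close>, and these add up to at most
  8.\<close>

lemma sum_proper_prime_powers_le:
  "(\<Sum>n | n \<in> {1..N} \<and> \<not> prime n. mangoldt n / real n) \<le> 8"
proof -
  have "(\<Sum>n | n \<in> {1..N} \<and> \<not> prime n. mangoldt n / real n)
      = (\<Sum>n | n \<in> {1..N} \<and> \<not> prime n \<and> primepow n. mangoldt n / real n)"
    by (rule sum.mono_neutral_right) (auto simp: mangoldt_def)
  \<comment> \<open>The bound is enlarged to all integers \<open>p\<close>, with the range ending at
    \<open>Suc N\<close> to match the telescoping estimate.\<close>
  also have "\<dots> \<le> (\<Sum>(p, k)\<in>{2..Suc N} \<times> {2..N}. ln (real p) * (1 / real p) ^ k)"
  proof (rule sum_le_included[where i = "\<lambda>(p, k). p ^ k"])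
    show "\<forall>n\<in>{n. n \<in> {1..N} \<and> \<not> prime n \<and> primepow n}. \<exists>pk\<in>{2..Suc N} \<times> {2..N}.
        (case pk of (p, k) \<Rightarrow> p ^ k) = n \<and>
        mangoldt n / real n \<le> (case pk of (p, k) \<Rightarrow> ln (real p) * (1 / real p) ^ k)"
    proof
      fix n assume n: "n \<in> {n. n \<in> {1..N} \<and> \<not> prime n \<and> primepow n}"
      then obtain p k where pk: "prime p" "k > 0" "n = p ^ k" by (auto simp: primepow_def)
      have p2: "p \<ge> 2" using pk(1) by (rule prime_ge_2_nat)
      have k2: "k \<ge> 2" using n pk by (cases "k = 1") auto
      have "k < 2 ^ k" by (rule less_exp)
      also have "(2::nat) ^ k \<le> p ^ k" using p2 by (intro power_mono) auto
      finally have "k \<le> N" using n pk by auto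
      moreover have "p \<le> N" using self_le_power[of p k] n pk p2 by auto
      moreover have "mangoldt n / real n = ln (real p) * (1 / real p) ^ k"
        using pk by (simp add: power_one_over)
      ultimately show "\<exists>pk\<in>{2..Suc N} \<times> {2..N}. (case pk of (p, k) \<Rightarrow> p ^ k) = n \<and>
          mangoldt n / real n \<le> (case pk of (p, k) \<Rightarrow> ln (real p) * (1 / real p) ^ k)"
        using p2 k2 pk(3) by (intro bexI[of _ "(p, k)"]) auto
    qed
  qed auto
  also have "\<dots> = (\<Sum>p=2..Suc N. ln (real p) * (\<Sum>k=2..N. (1 / real p) ^ k))"
    by (simp add: sum.cartesian_product sum_distrib_left)
  also have "\<dots> \<le> (\<Sum>p=2..Suc N. 4 * (1 / (real p * sqrt (real p))))"
  proof (intro sum_mono)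
    fix p assume p: "p \<in> {2..Suc N}"
    define x where "x = 1 / real p"
    have x: "0 < x" "x \<le> 1 / 2" using p by (auto simp: x_def field_simps)
    \<comment> \<open>The subtracted term carries the induction; its step uses
      \<open>2 * x \<le> 1\<close>.\<close>
    have "(\<Sum>k=2..M. x ^ k) \<le> 2 * x\<^sup>2 - 2 * x ^ Suc M" if "M \<ge> 1" for M
      using that
    proof (induction M rule: dec_induct)
      case base
      show ?case by (simp add: power2_eq_square)
    next
      case (step M)
      have "2 * x ^ Suc (Suc M) \<le> x ^ Suc M"
        using mult_right_mono[of "2 * x" 1 "x ^ Suc M"] x by simp
      then show ?case using step by simp
    qed
    from this[of N] have "(\<Sum>k=2..N. x ^ k) \<le> 2 * x\<^sup>2"
      using x by (cases "N \<ge> 1") (auto intro: order.trans)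
    moreover have "ln (real p) \<le> 2 * sqrt (real p)"
      using ln_le_minus_one[of "sqrt (real p)"] p by (simp add: ln_sqrt)
    ultimately have "ln (real p) * (\<Sum>k=2..N. x ^ k) \<le> 2 * sqrt (real p) * (2 * x\<^sup>2)"
      using p x by (intro mult_mono) (auto intro!: sum_nonneg)
    also have "\<dots> = 4 * (sqrt (real p) / (real p * real p))" by (simp add: x_def power2_eq_square)
    also have "sqrt (real p) / (real p * real p) = 1 / (real p * sqrt (real p))"
      using p by (simp add: field_simps)
    finally show "ln (real p) * (\<Sum>k=2..N. (1 / real p) ^ k) \<le> 4 * (1 / (real p * sqrt (real p)))"
      by (simp add: x_def)
  qed
  also have "\<dots> = 4 * (\<Sum>p=2..Suc N. 1 / (real p * sqrt (real p)))"
    by (simp only: sum_distrib_left)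
  also have "\<dots> \<le> 4 * 2"
  proof -
    have "2 / sqrt (real (Suc N)) \<ge> 0" by simp
    then show ?thesis using sum_inverse_n_sqrt_n_le[of N] by linarith
  qed
  finally show ?thesis by simp
qed

text \<open>Applied twice: to the prime factors of the modulus, and to the primes of the residue
  class when these are assumed finite.\<close>

lemma sum_mangoldt_finite_primes_le:
  assumes P: "finite P"
  shows "(\<Sum>n | n \<in> {1..N} \<and> (prime n \<longrightarrow> n \<in> P). mangoldt n / real n)
    \<le> 8 + (\<Sum>p\<in>P. mangoldt p / real p)"
proof -
  have "(\<Sum>n | n \<in> {1..N} \<and> (prime n \<longrightarrow> n \<in> P). mangoldt n / real n)
      \<le> (\<Sum>n\<in>{n. n \<in> {1..N} \<and> \<not> prime n} \<union> P. mangoldt n / real n)"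
    using P by (intro sum_mono2) (auto simp: mangoldt_nonneg)
  also have "\<dots> \<le> (\<Sum>n | n \<in> {1..N} \<and> \<not> prime n. mangoldt n / real n) + (\<Sum>n\<in>P. mangoldt n / real n)"
  proof -
    have "(\<Sum>n\<in>{n. n \<in> {1..N} \<and> \<not> prime n} \<inter> P. mangoldt n / real n) \<ge> 0"
      by (intro sum_nonneg) (auto simp: mangoldt_nonneg)
    then show ?thesis
      using sum.union_inter[of "{n. n \<in> {1..N} \<and> \<not> prime n}" P "\<lambda>n. mangoldt n / real n"] P by simp
  qed
  finally show ?thesis using sum_proper_prime_powers_le[of N] by linarith
qed

text \<open>If the class held finitely many primes, its sum would be bounded, as are the
  nonprincipal sums; orthogonality would then bound the principal sum, which exceeds
  \<open>ln N\<close> minus a constant.\<close>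

theorem dirichlet_primes_in_progression:
  fixes q a :: nat
  assumes q: "squarefree q" and a: "coprime a q"
  shows "infinite {p. prime p \<and> [p = a] (mod q)}"
proof
  assume fin: "finite {p. prime p \<and> [p = a] (mod q)}"
  have q0: "q > 0" using q by (cases "q = 0") auto
  define F where "F = (\<lambda>\<chi> N. \<Sum>n=1..N. \<chi> n / of_nat n * mangoldt n :: complex)"
  define X where "X = dirichlet_chars q - {principal_char q}"
  have finX: "finite X" using finite_dirichlet_chars[OF q0] by (simp add: X_def)
  have "\<forall>\<chi>\<in>X. \<exists>C. \<forall>N. norm (F \<chi> N) \<le> C"
    unfolding F_def X_def using sum_char_mangoldt_bounded q0 dirichlet_L1_neq_0[OF q] by blast
  then obtain C where C: "\<And>\<chi> N. \<chi> \<in> X \<Longrightarrow> norm (F \<chi> N) \<le> C \<chi>" by metis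
  define h where "h = real (card (dirichlet_chars q))"
  define B where "B = (\<lambda>P. 8 + (\<Sum>p\<in>P. mangoldt p / real p :: real))"
  have "ln (real N) \<le> 1 + B (prime_factors q) + (\<Sum>\<chi>\<in>X. C \<chi>) + h * B {p. prime p \<and> [p = a] (mod q)}"
    if N: "N > 0" for N
  proof -
    have prin: "F (principal_char q) N = of_real (\<Sum>n | n \<in> {1..N} \<and> coprime n q. mangoldt n / real n)"
    proof -
      have "F (principal_char q) N = (\<Sum>n=1..N. if coprime n q then of_real (mangoldt n / real n) else 0)"
        unfolding F_def by (intro sum.cong refl) (simp add: principal_char_def)
      also have "\<dots> = (\<Sum>n | n \<in> {1..N} \<and> coprime n q. of_real (mangoldt n / real n))"
        by (subst sum.inter_filter[symmetric]) auto
      finally show ?thesis by simp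
    qed
    have "ln (real N) - 1 \<le> (\<Sum>n=1..N. mangoldt n / real n)" by (rule sum_mangoldt_over_ge[OF N])
    also have "\<dots> = (\<Sum>n | n \<in> {1..N} \<and> coprime n q. mangoldt n / real n)
        + (\<Sum>n | n \<in> {1..N} \<and> \<not> coprime n q. mangoldt n / real n)"
      by (subst sum.union_disjoint[symmetric]) (auto intro!: sum.cong)
    \<comment> \<open>A prime \<open>n\<close> that is not coprime to \<open>q\<close> divides
      \<open>q\<close>.\<close>
    also have "(\<Sum>n | n \<in> {1..N} \<and> \<not> coprime n q. mangoldt n / real n)
        \<le> (\<Sum>n | n \<in> {1..N} \<and> (prime n \<longrightarrow> n \<in> prime_factors q). mangoldt n / real n)"
      using q0 by (intro sum_mono2) (auto simp: mangoldt_nonneg prime_factors_dvd dest: prime_imp_coprime)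
    also have "\<dots> \<le> B (prime_factors q)" unfolding B_def by (rule sum_mangoldt_finite_primes_le) auto
    finally have lower: "ln (real N) \<le> 1 + B (prime_factors q) + Re (F (principal_char q) N)"
      unfolding prin by simp
    have "(\<Sum>\<chi>\<in>dirichlet_chars q. cnj (\<chi> a) * F \<chi> N)
        = cnj (principal_char q a) * F (principal_char q) N + (\<Sum>\<chi>\<in>X. cnj (\<chi> a) * F \<chi> N)"
      unfolding X_def using finite_dirichlet_chars[OF q0] principal_char_in by (rule sum.remove)
    \<comment> \<open>The coefficient \<open>cnj (principal_char q a)\<close> is 1, so the identity
      can be solved for the principal sum.\<close>
    then have "F (principal_char q) N = (\<Sum>\<chi>\<in>dirichlet_chars q. cnj (\<chi> a) * F \<chi> N) - (\<Sum>\<chi>\<in>X. cnj (\<chi> a) * F \<chi> N)"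
      using a by (simp add: principal_char_def)
    then have "F (principal_char q) N = of_real (h * (\<Sum>n | n \<in> {1..N} \<and> [n = a] (mod q). mangoldt n / real n))
        - (\<Sum>\<chi>\<in>X. cnj (\<chi> a) * F \<chi> N)"
      unfolding F_def h_def by (simp only: sum_chars_mangoldt[OF q a])
    then have "Re (F (principal_char q) N) = h * (\<Sum>n | n \<in> {1..N} \<and> [n = a] (mod q). mangoldt n / real n)
        - Re (\<Sum>\<chi>\<in>X. cnj (\<chi> a) * F \<chi> N)" by simp
    moreover have "norm (\<Sum>\<chi>\<in>X. cnj (\<chi> a) * F \<chi> N) \<le> (\<Sum>\<chi>\<in>X. C \<chi>)"
    proof (intro sum_norm_le)
      fix \<chi> assume \<chi>: "\<chi> \<in> X"
      have "norm (\<chi> a) * norm (F \<chi> N) \<le> 1 * C \<chi>"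
        using \<chi> norm_dirichlet_char_le[of \<chi> q a] q0 C by (intro mult_mono) (auto simp: X_def)
      then show "norm (cnj (\<chi> a) * F \<chi> N) \<le> C \<chi>" by (simp add: norm_mult)
    qed
    then have "- Re (\<Sum>\<chi>\<in>X. cnj (\<chi> a) * F \<chi> N) \<le> (\<Sum>\<chi>\<in>X. C \<chi>)"
      using abs_Re_le_cmod[of "\<Sum>\<chi>\<in>X. cnj (\<chi> a) * F \<chi> N"] by linarith
    moreover have "(\<Sum>n | n \<in> {1..N} \<and> [n = a] (mod q). mangoldt n / real n) \<le> B {p. prime p \<and> [p = a] (mod q)}"
    proof -
      have "(\<Sum>n | n \<in> {1..N} \<and> [n = a] (mod q). mangoldt n / real n)
          \<le> (\<Sum>n | n \<in> {1..N} \<and> (prime n \<longrightarrow> n \<in> {p. prime p \<and> [p = a] (mod q)}). mangoldt n / real n)"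
        by (intro sum_mono2) (auto simp: mangoldt_nonneg)
      also have "\<dots> \<le> B {p. prime p \<and> [p = a] (mod q)}"
        unfolding B_def by (rule sum_mangoldt_finite_primes_le[OF fin])
      finally show ?thesis .
    qed
    then have "h * (\<Sum>n | n \<in> {1..N} \<and> [n = a] (mod q). mangoldt n / real n)
        \<le> h * B {p. prime p \<and> [p = a] (mod q)}"
      by (intro mult_left_mono) (auto simp: h_def)
    ultimately show ?thesis using lower by linarith
  qed
  then show False
    using unbounded_ln[of "1 + B (prime_factors q) + (\<Sum>\<chi>\<in>X. C \<chi>) + h * B {p. prime p \<and> [p = a] (mod q)}"]
    by (meson not_le)
qed

section \<open>The covering\<close>

text \<open>Euler's observation: modulo \<open>p\<close> the power \<open>2 ^ (2 ^ k)\<close> is -1,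
  which differs from 1 since \<open>p\<close> is odd. So the order of 2 divides
  \<open>2 ^ Suc k\<close> but not \<open>2 ^ k\<close>, hence equals \<open>2 ^ Suc k\<close>, and
  it divides \<open>p - 1\<close>.\<close>

lemma prime_divisor_fermat_number:
  fixes p :: nat
  assumes p: "prime p" and dvd: "p dvd 2 ^ (2 ^ k) + 1"
  shows "2 ^ Suc k dvd p - 1"
proof -
  have "p \<noteq> 2"
  proof
    assume "p = 2"
    with dvd show False by simp
  qed
  then have p2: "odd p" "p > 2" using p prime_odd_nat[of p] prime_gt_1_nat[OF p] by auto
  have cop: "coprime p 2" using p2 by simp
  have one: "[2 ^ (2 ^ Suc k) = 1] (mod p)"
  proof -
    have "(2 :: nat) ^ (2 ^ Suc k) = (2 ^ (2 ^ k)) ^ 2" by (simp only: power_mult[symmetric] power_Suc mult.commute)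
    also have "(2 ^ (2 ^ k)) ^ 2 - 1 = (2 ^ (2 ^ k) + 1) * ((2 :: nat) ^ (2 ^ k) - 1)"
      by (simp add: power2_eq_square algebra_simps)
    finally have "p dvd 2 ^ (2 ^ Suc k) - 1" using dvd by (simp only: dvd_mult2)
    then show ?thesis by (simp add: cong_altdef_nat)
  qed
  then have "ord p 2 dvd 2 ^ Suc k" by (simp only: ord_divides)
  then obtain i where i: "i \<le> Suc k" "ord p 2 = 2 ^ i"
    using divides_primepow_nat[of 2 "ord p 2" "Suc k"] by (auto simp del: power_Suc)
  have "i = Suc k"
  proof (rule ccontr)
    assume "i \<noteq> Suc k"
    then have "ord p 2 dvd 2 ^ k" using i by (simp add: le_imp_power_dvd)
    then have "[2 ^ (2 ^ k) = 1] (mod p)" by (simp only: ord_divides)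
    then have "[2 ^ (2 ^ k) + 1 = 1 + 1] (mod p)" by (rule cong_add) simp
    then have "p dvd 2" using dvd by (metis cong_dvd_iff one_add_one)
    then show False using p2(2) by (auto dest: dvd_imp_le)
  qed
  with i have "2 ^ Suc k dvd totient p" using cop order_divides_totient[of p 2] by simp
  then show ?thesis using p by (simp add: totient_prime)
qed

section \<open>Primality of the larger prime divisors of the modulus\<close>

lemma prime_nat_by_trial_division:
  fixes n :: nat
  assumes n: "1 < n" "n < (Suc m)\<^sup>2" and div: "\<And>p. prime p \<Longrightarrow> p \<le> m \<Longrightarrow> \<not> p dvd n"
  shows "prime n"
proof (rule ccontr)
  assume "\<not> prime n"
  then obtain a where a: "a dvd n" "a \<noteq> 1" "a \<noteq> n" using n(1) by (auto simp: prime_nat_iff)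
  then obtain b where b: "n = a * b" by auto
  have le: False if d: "d \<le> m" "d dvd n" "d \<noteq> 1" for d
  proof -
    obtain p where p: "prime p" "p dvd d" using prime_factor_nat[OF d(3)] by blast
    have "d > 0" using d(2) n(1) by (auto intro!: Nat.gr0I)
    with p have "p \<le> m" using d(1) dvd_imp_le order.trans by blast
    with p d(2) show False using div dvd_trans by blast
  qed
  have "a \<le> m \<or> b \<le> m"
  proof (rule ccontr)
    assume "\<not> (a \<le> m \<or> b \<le> m)"
    then have "Suc m * Suc m \<le> a * b" by (intro mult_le_mono) auto
    then show False using n(2) b by (simp add: power2_eq_square)
  qed
  then show False using le[of a] le[of b] a b by auto
qed

text \<open>Every prime factor of \<open>n\<close> is 1 modulo \<open>2 ^ Suc k\<close>, so trial
  division tests only \<open>j\<close> candidates. They are indexed by a list so that the simplifier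
  can unroll them.\<close>

lemma prime_by_fermat_number:
  fixes n :: nat
  assumes n: "1 < n" "n < (Suc (2 ^ Suc k * j))\<^sup>2" "n dvd 2 ^ (2 ^ k) + 1"
    and div: "\<forall>i\<in>set [1..<Suc j]. \<not> (2 ^ Suc k * i + 1) dvd n"
  shows "prime n"
proof (rule prime_nat_by_trial_division[OF n(1,2)])
  fix p assume p: "prime p" "p \<le> 2 ^ Suc k * j"
  show "\<not> p dvd n"
  proof
    assume "p dvd n"
    then have "2 ^ Suc k dvd p - 1" using n(3) p(1) dvd_trans prime_divisor_fermat_number by blast
    then obtain i where "p - 1 = 2 ^ Suc k * i" by (elim dvdE)
    then have i: "p = 2 ^ Suc k * i + 1" using prime_gt_0_nat[OF p(1)] by simp
    then have "i \<noteq> 0" using p(1) by (intro notI) simp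
    have "2 ^ Suc k * i \<le> 2 ^ Suc k * j" using p(2) i by linarith
    then have "i \<le> j" by simp
    with \<open>i \<noteq> 0\<close> have "i \<in> set [1..<Suc j]" by (simp add: set_upt del: upt_Suc)
    with div i \<open>p dvd n\<close> show False by blast
  qed
qed

text \<open>The numerals in this proof and the next three are \<open>k\<close> and \<open>j\<close>.
  Here 257 and 65537 are Fermat numbers themselves, while 641 and 6700417 are the factors of
  \<open>2 ^ 32 + 1\<close>; \<open>j\<close> is the least value satisfying the square
  bound.\<close>

lemma prime_257: "prime (257 :: nat)"
  by (rule prime_by_fermat_number[of _ 3 1]) (simp_all del: set_upt add: upt_conv_Cons)

lemma prime_641: "prime (641 :: nat)"
  by (rule prime_by_fermat_number[of _ 5 1]) (simp_all del: set_upt add: upt_conv_Cons)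

lemma prime_65537: "prime (65537 :: nat)"
  by (rule prime_by_fermat_number[of _ 4 8]) (simp_all del: set_upt add: upt_conv_Cons)

lemma prime_6700417: "prime (6700417 :: nat)"
  by (rule prime_by_fermat_number[of _ 5 41]) (simp_all del: set_upt add: upt_conv_Cons)

lemma squarefree_modulus: "squarefree (36893488147419103230 :: nat)"
proof -
  define S :: "nat set" where "S = {2, 3, 5, 17, 257, 641, 65537, 6700417}"
  have prime: "prime p" if "p \<in> S" for p
  proof -
    from that have "p \<in> {257, 641, 65537, 6700417} \<or> p \<in> {2, 3, 5, 17}" by (auto simp: S_def)
    then show ?thesis
    proof
      assume "p \<in> {257, 641, 65537, 6700417}"
      then show ?thesis
        by (elim insertE emptyE) (simp_all only: prime_257 prime_641 prime_65537 prime_6700417)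
    qed auto
  qed
  have "squarefree (\<Prod>p\<in>S. p)"
    by (intro squarefree_prod_coprime squarefree_prime primes_coprime prime)
  also have "(\<Prod>p\<in>S. p) = 36893488147419103230"
    by (simp add: S_def)
  finally show ?thesis .
qed

text \<open>Modulo \<open>r\<close> the power \<open>2 ^ n\<close> depends only on
  \<open>n mod t\<close>, so the divisibility at the single exponent \<open>c\<close> holds on its
  whole residue class.\<close>

lemma covering_dvd:
  fixes k b r t c n :: nat
  assumes "[k = b] (mod r)" "[2 ^ t = 1] (mod r)" "r dvd b * 2 ^ c + 1" "n mod t = c"
  shows "r dvd k * 2 ^ n + 1"
proof -
  have "n = t * (n div t) + c" using assms(4) by auto
  then have "2 ^ n = (2 ^ t) ^ (n div t) * (2 :: nat) ^ c" by (metis power_add power_mult)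
  moreover have "[(2 ^ t) ^ (n div t) * 2 ^ c = 1 ^ (n div t) * 2 ^ c] (mod r)"
    by (intro cong_mult cong_pow assms(2) cong_refl)
  ultimately have "[2 ^ n = 2 ^ c] (mod r)" by simp
  then have "[k * 2 ^ n + 1 = b * 2 ^ c + 1] (mod r)"
    using assms(1) by (intro cong_add cong_mult) auto
  then show ?thesis using assms(3) by (simp add: cong_dvd_iff)
qed

text \<open>All moduli divide 64, so 64 cases suffice. After the even numbers, each congruence takes
  one half of the class of 1 modulo the previous power of 2, and modulus 64 takes both remaining
  halves.\<close>

lemma residues_mod_64_covered:
  fixes n :: nat
  shows "n mod 2 = 0 \<or> n mod 4 = 3 \<or> n mod 8 = 5 \<or> n mod 16 = 9 \<or> n mod 32 = 17 \<or>
    n mod 64 = 33 \<or> n mod 64 = 1"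
proof -
  have "\<forall>x\<in>set [0..<64 :: nat]. x mod 2 = 0 \<or> x mod 4 = 3 \<or> x mod 8 = 5 \<or> x mod 16 = 9 \<or>
      x mod 32 = 17 \<or> x mod 64 = 33 \<or> x mod 64 = 1"
    by (simp del: set_upt add: upt_conv_Cons)
  from bspec[OF this, of "n mod 64"] show ?thesis by (auto simp: mod_mod_cancel)
qed

lemma sierpinski_number_of_progression:
  fixes k :: nat
  assumes k: "k = 36893488147419103230 * m + 10691053702625738573"
  shows "sierpinski_number k"
proof -
  have cong: "[k = 10691053702625738573] (mod r)" if "r dvd 36893488147419103230" for r
  proof -
    have "[36893488147419103230 * m + 10691053702625738573 = 0 + 10691053702625738573] (mod r)"
      using that by (intro cong_add) (auto simp: cong_0_iff)
    then show ?thesis by (simp add: k)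
  qed
  have "composite (k * 2 ^ n + 1)" for n
  proof -
    have "3 dvd k * 2 ^ n + 1 \<or> 5 dvd k * 2 ^ n + 1 \<or> 17 dvd k * 2 ^ n + 1 \<or> 257 dvd k * 2 ^ n + 1 \<or>
      65537 dvd k * 2 ^ n + 1 \<or> 6700417 dvd k * 2 ^ n + 1 \<or> 641 dvd k * 2 ^ n + 1"
      \<comment> \<open>The numerals after each prime are the period \<open>t\<close> and the
        covered residue \<open>c\<close>.\<close>
      using covering_dvd[OF cong[of 3], of 2 0 n] covering_dvd[OF cong[of 5], of 4 3 n]
        covering_dvd[OF cong[of 17], of 8 5 n] covering_dvd[OF cong[of 257], of 16 9 n]
        covering_dvd[OF cong[of 65537], of 32 17 n] covering_dvd[OF cong[of 6700417], of 64 33 n]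
        covering_dvd[OF cong[of 641], of 64 1 n] residues_mod_64_covered[of n]
      by (simp add: cong_def) argo
    then obtain r where r: "r dvd k * 2 ^ n + 1" "1 < r" "r \<le> 6700417"
      by (elim disjE) auto
    \<comment> \<open>The constant term of the progression already exceeds the largest covering
      prime, so the divisor \<open>r\<close> is proper.\<close>
    have "6700417 * 1 \<le> k * 2 ^ n" unfolding k by (intro mult_le_mono) auto
    then have "r < k * 2 ^ n + 1" using r(3) by linarith
    then have "\<not> prime (k * 2 ^ n + 1)" using r(1,2) by (auto simp: prime_nat_iff)
    then show ?thesis unfolding composite_def using r(2) \<open>r < k * 2 ^ n + 1\<close> by linarith
  qed
  moreover have "k > 0" "odd k" by (auto simp: k)
  ultimately show ?thesis by (simp add: sierpinski_number_def)
qed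

theorem corollary1:
  fixes A B :: nat
  assumes "A = 36893488147419103230" and "B = 10691053702625738573"
  shows "infinite {p. (\<exists>m::nat. p = A * m + B) \<and> prime p \<and> sierpinski_number p}"
proof -
  have "coprime B A" unfolding assms coprime_iff_invertible_nat
    \<comment> \<open>The witness is the inverse of \<open>B\<close> modulo
      \<open>A\<close>.\<close>
    by (intro exI[of _ 24317470736793402677]) (simp add: cong_def)
  \<comment> \<open>Keeping only \<open>p \<ge> B\<close> makes the natural subtraction
    \<open>p - B\<close> exact, so that the congruence yields a nonnegative
    \<open>m\<close>.\<close>
  then have "infinite ({p. prime p \<and> [p = B] (mod A)} - {..<B})"
    using squarefree_modulus assms(1)
    by (intro Diff_infinite_finite dirichlet_primes_in_progression) auto
  moreover have "{p. prime p \<and> [p = B] (mod A)} - {..<B}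
      \<subseteq> {p. (\<exists>m::nat. p = A * m + B) \<and> prime p \<and> sierpinski_number p}"
  proof
    fix p assume "p \<in> {p. prime p \<and> [p = B] (mod A)} - {..<B}"
    then have p: "prime p" "[p = B] (mod A)" "B \<le> p" by auto
    then have "A dvd p - B" by (simp add: cong_altdef_nat)
    then obtain m where "p - B = A * m" by (elim dvdE)
    then have m: "p = A * m + B" using p(3) by auto
    then have "sierpinski_number p" using sierpinski_number_of_progression[of p m] assms by simp
    with m p(1) show "p \<in> {p. (\<exists>m::nat. p = A * m + B) \<and> prime p \<and> sierpinski_number p}"
      by blast
  qed
  ultimately show ?thesis using finite_subset by blast
qed

end
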